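(* If $\mathfrak{s}<\mathfrak{b}$, then $\mathfrak{s}=\mathfrak{s}_{\omega,\omega}$. Consequently, if $\mathfrak{s}<\mathfrak{b}$, then there is a weakly tight family $\mathscr{A}\subset[\omega]^{\omega}$ of size $\mathfrak{c}$.
   Context: We work in ZFC. $[\omega]^{\omega}$ is the set of infinite subsets of $\omega$, $\mathfrak{c}=2^{\aleph_0}$, $\bar e = \omega\setminus e$ for $e \subset \omega$, and $\exists^{\infty} n$ means "for infinitely many $n\in\omega$". $\mathfrak{b}$ is the bounding number (least size of an unbounded family in $\omega^{\omega}$ under eventual domination). $\mathfrak{s}$ is the splitting number: the least size of a family $\{e_\alpha:\alpha<\kappa\}\subset[\omega]^{\omega}$ such that for every $b\in[\omega]^{\omega}$ there is $\alpha$ with $|b\cap e_\alpha|=|b\cap\bar e_\alpha|=\omega$. $\mathfrak{s}_{\omega,\omega}$ is the least cardinal $\kappa$ such that there is a family $\{e_\alpha : \alpha<\kappa\}\subset[\omega]^{\omega}$ such that for any collection $\{b_n : n\in\omega\}\subset[\omega]^{\omega}$ there exists $\alpha<\kappa$ with $\exists^{\infty} n\in\omega\,(|b_n\cap e_\alpha|=\omega)$ and $\exists^{\infty} n\in\omega\,(|b_n\cap \bar e_\alpha|=\omega)$. A family $\mathscr{A}\subset[\omega]^{\omega}$ is almost disjoint (a.d.) if any two distinct members have finite intersection. $\mathcal{I}(\mathscr{A})$ is the ideal on $\omega$ generated by $\mathscr{A}$ (ideals on $\omega$ contain all finite sets, so $x\in\mathcal{I}(\mathscr{A})$ iff $x\setminus\bigcup\mathcal{F}$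 is finite for some finite $\mathcal{F}\subset\mathscr{A}$), and $\mathcal{I}^{+}(\mathscr{A})=\mathcal{P}(\omega)\setminus\mathcal{I}(\mathscr{A})$. An a.d. family $\mathscr{A}\subset[\omega]^{\omega}$ is weakly tight if for every countable collection $\{b_n : n\in\omega\}\subset\mathcal{I}^{+}(\mathscr{A})$ there is $a\in\mathscr{A}$ such that $\exists^{\infty} n\in\omega\,(|b_n\cap a|=\omega)$. *)

theory Defs
  imports "HOL-Library.Infinite_Set" "HOL-Library.Nat_Bijection"
begin

unbundle cardinal_syntax

text \<open>
  Cardinals are the well-order relations of the library, compared by \<open>\<le>o\<close>, \<open><o\<close> and \<open>=o\<close>; these
  comparisons are heterogeneous, and \<open>=o\<close> is equality of cardinals, whereas plain equality of
  relations would depend on the chosen representatives.  The least size of a family satisfying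
  \<open>P\<close> is determined up to \<open>=o\<close> as soon as some family satisfies \<open>P\<close>, which is shown below for
  each \<open>P\<close> that is used.
\<close>

definition least_size :: "('a set \<Rightarrow> bool) \<Rightarrow> 'a rel" where
  "least_size P = (SOME \<kappa>. (\<exists>X. P X \<and> \<kappa> = |X| ) \<and> (\<forall>Y. P Y \<longrightarrow> \<kappa> \<le>o |Y| ))"

lemma least_size:
  assumes "\<exists>X. P X"
  shows "\<exists>X. P X \<and> least_size P = |X|" and "P Y \<Longrightarrow> least_size P \<le>o |Y|"
proof -
  have "\<exists>\<kappa> \<in> {|X| | X. P X}. \<forall>\<kappa>' \<in> {|X| | X. P X}. \<kappa> \<le>o \<kappa>'"
    by (rule exists_minim_Card_order) (use assms card_of_Card_order in auto)
  then have "\<exists>\<kappa>. (\<exists>X. P X \<and> \<kappa> = |X| ) \<and> (\<forall>Y. P Y \<longrightarrow> \<kappa> \<le>o |Y| )"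
    by blast
  then have *: "(\<exists>X. P X \<and> least_size P = |X| ) \<and> (\<forall>Y. P Y \<longrightarrow> least_size P \<le>o |Y| )"
    unfolding least_size_def by (rule someI_ex)
  show "\<exists>X. P X \<and> least_size P = |X|" using * by blast
  show "P Y \<Longrightarrow> least_size P \<le>o |Y|" using * by blast
qed

text \<open>Allowing indexed families with repetitions gives the same least cardinal.\<close>

lemma least_size_indexed:
  assumes "P (e ` I)"
  shows "least_size P \<le>o |I|"
proof -
  have "least_size P \<le>o |e ` I|"
    using assms by (intro least_size(2)) auto
  then show ?thesis
    using card_of_image ordLeq_transitive by blast
qed

definition inf_subsets :: "nat set set" where
  "inf_subsets = {e. infinite e}"

definition continuum :: "(nat \<Rightarrow> bool) rel" where
  "continuum = ctwo ^c natLeq"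

definition eventually_le :: "(nat \<Rightarrow> nat) \<Rightarrow> (nat \<Rightarrow> nat) \<Rightarrow> bool" (infix \<open>\<le>\<^sup>*\<close> 50) where
  "f \<le>\<^sup>* g \<longleftrightarrow> (\<forall>\<^sub>\<infinity>n. f n \<le> g n)"

definition unbounded_family :: "(nat \<Rightarrow> nat) set \<Rightarrow> bool" where
  "unbounded_family F \<longleftrightarrow> \<not> (\<exists>g. \<forall>f\<in>F. f \<le>\<^sup>* g)"

definition bounding_number :: "(nat \<Rightarrow> nat) rel" (\<open>\<bb>\<close>) where
  "\<bb> = least_size unbounded_family"

definition splitting_family :: "nat set set \<Rightarrow> bool" where
  "splitting_family S \<longleftrightarrow> S \<subseteq> inf_subsets \<and>
     (\<forall>b\<in>inf_subsets. \<exists>e\<in>S. infinite (b \<inter> e) \<and> infinite (b \<inter> - e))"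

definition splitting_number :: "nat set rel" (\<open>\<ss>\<close>) where
  "\<ss> = least_size splitting_family"

definition omega_omega_splitting_family :: "nat set set \<Rightarrow> bool" where
  "omega_omega_splitting_family S \<longleftrightarrow> S \<subseteq> inf_subsets \<and>
     (\<forall>b :: nat \<Rightarrow> nat set. range b \<subseteq> inf_subsets \<longrightarrow>
        (\<exists>e\<in>S. (\<exists>\<^sub>\<infinity>n. infinite (b n \<inter> e)) \<and> (\<exists>\<^sub>\<infinity>n. infinite (b n \<inter> - e))))"

definition omega_omega_splitting_number :: "nat set rel" (\<open>\<ss>\<^sub>\<omega>\<^sub>\<omega>\<close>) where
  "\<ss>\<^sub>\<omega>\<^sub>\<omega> = least_size omega_omega_splitting_family"

lemma unbounded_family_UNIV: "unbounded_family UNIV"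
proof -
  have "\<not> (\<lambda>n. Suc (g n)) \<le>\<^sup>* g" for g
    by (simp add: eventually_le_def)
  then show ?thesis
    unfolding unbounded_family_def by blast
qed

lemma omega_omega_splitting_family_inf_subsets: "omega_omega_splitting_family inf_subsets"
  unfolding omega_omega_splitting_family_def
proof (intro conjI allI impI)
  fix b :: "nat \<Rightarrow> nat set"
  assume b: "range b \<subseteq> inf_subsets"
  then have binf: "infinite (b n)" for n
    by (auto simp: inf_subsets_def)
  define idx :: "nat \<Rightarrow> nat" where "idx k = fst (prod_decode (k div 2))" for k
  have "\<exists>f. \<forall>k. f k \<in> b (idx k) \<and> f k < f (Suc k)"
  proof (rule dependent_nat_choice)
    show "\<exists>x. x \<in> b (idx 0)"
      using binf[of "idx 0"] infinite_imp_nonempty by blast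
    show "\<exists>y. y \<in> b (idx (Suc k)) \<and> x < y" for x k
      using binf[of "idx (Suc k)"] unfolding infinite_nat_iff_unbounded by blast
  qed
  then obtain f where f: "\<And>k. f k \<in> b (idx k)" and "\<And>k. f k < f (Suc k)"
    by blast
  then have "strict_mono f"
    by (simp add: strict_mono_Suc_iff)
  then have inj: "inj f"
    by (rule strict_mono_imp_inj_on)
  define e where "e = f ` {k. even k}"
  define h :: "nat \<Rightarrow> nat \<Rightarrow> nat" where "h n i = 2 * prod_encode (n, i)" for n i
  have infin: "infinite (range (\<lambda>i. f (h n i + d)))" for n d
    by (rule range_inj_infinite) (auto intro!: injI dest!: injD[OF inj] simp: h_def prod_encode_eq)
  have "range (\<lambda>i. f (h n i + 0)) \<subseteq> b n \<inter> e" for n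
    using f[of "h n _"] by (auto simp: e_def h_def idx_def)
  then have *: "infinite (b n \<inter> e)" for n
    using infin infinite_super by blast
  have "range (\<lambda>i. f (h n i + 1)) \<subseteq> b n \<inter> - e" for n
    using f[of "h n _ + 1"] by (auto simp: e_def h_def idx_def dest!: injD[OF inj] split: prod.splits)
  then have **: "infinite (b n \<inter> - e)" for n
    using infin infinite_super by blast
  have "e \<in> inf_subsets"
    using *[of 0] by (auto simp: inf_subsets_def)
  then show "\<exists>e\<in>inf_subsets. (\<exists>\<^sub>\<infinity>n. infinite (b n \<inter> e)) \<and> (\<exists>\<^sub>\<infinity>n. infinite (b n \<inter> - e))"
    using * ** by (intro bexI[of _ e]) auto
qed simp

lemma splitting_family_inf_subsets: "splitting_family inf_subsets"
  unfolding splitting_family_def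
proof (intro conjI ballI)
  fix b assume "b \<in> inf_subsets"
  then have "\<exists>e\<in>inf_subsets. (\<exists>\<^sub>\<infinity>n::nat. infinite (b \<inter> e)) \<and> (\<exists>\<^sub>\<infinity>n::nat. infinite (b \<inter> - e))"
    using omega_omega_splitting_family_inf_subsets
    unfolding omega_omega_splitting_family_def by (elim conjE allE[of _ "\<lambda>_. b"]) simp
  then show "\<exists>e\<in>inf_subsets. infinite (b \<inter> e) \<and> infinite (b \<inter> - e)"
    by simp
qed simp

definition almost_disjoint :: "nat set set \<Rightarrow> bool" where
  "almost_disjoint A \<longleftrightarrow> A \<subseteq> inf_subsets \<and> (\<forall>a\<in>A. \<forall>a'\<in>A. a \<noteq> a' \<longrightarrow> finite (a \<inter> a'))"

text \<open>Ideals need not be proper; they are required to contain all finite sets.\<close>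

definition ideal_on_omega :: "nat set set \<Rightarrow> bool" where
  "ideal_on_omega I \<longleftrightarrow> (\<forall>x. finite x \<longrightarrow> x \<in> I) \<and>
     (\<forall>x\<in>I. \<forall>y\<subseteq>x. y \<in> I) \<and> (\<forall>x\<in>I. \<forall>y\<in>I. x \<union> y \<in> I)"

definition generated_ideal :: "nat set set \<Rightarrow> nat set set" where
  "generated_ideal A = \<Inter> {I. ideal_on_omega I \<and> A \<subseteq> I}"

definition positive_sets :: "nat set set \<Rightarrow> nat set set" where
  "positive_sets A = UNIV - generated_ideal A"

lemma generated_ideal_iff:
  "x \<in> generated_ideal A \<longleftrightarrow> (\<exists>F\<subseteq>A. finite F \<and> finite (x - \<Union>F))"
proof
  let ?I = "{x. \<exists>F\<subseteq>A. finite F \<and> finite (x - \<Union>F)}"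
  have Un: "x \<union> y \<in> ?I" if xy: "x \<in> ?I" "y \<in> ?I" for x y
  proof -
    obtain F G where FG: "F \<subseteq> A" "finite F" "finite (x - \<Union>F)" "G \<subseteq> A" "finite G" "finite (y - \<Union>G)"
      using xy by blast
    have "finite (x \<union> y - \<Union>(F \<union> G))"
      by (rule finite_subset[of _ "(x - \<Union>F) \<union> (y - \<Union>G)"]) (use FG in auto)
    then show ?thesis
      using FG by (intro CollectI exI[of _ "F \<union> G"]) auto
  qed
  have sub: "y \<in> ?I" if xy: "x \<in> ?I" "y \<subseteq> x" for x y
  proof -
    obtain F where F: "F \<subseteq> A" "finite F" "finite (x - \<Union>F)"
      using xy(1) by blast
    have "finite (y - \<Union>F)"
      by (rule finite_subset[OF _ F(3)]) (use xy(2) in auto)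
    then show ?thesis
      using F(1,2) by blast
  qed
  have fin: "x \<in> ?I" if "finite x" for x
    using that by (intro CollectI exI[of _ "{}"]) auto
  have "ideal_on_omega ?I"
    unfolding ideal_on_omega_def
    by (intro conjI allI ballI impI) (rule fin sub Un; assumption)+
  moreover have "A \<subseteq> ?I"
  proof
    fix a assume "a \<in> A"
    then show "a \<in> ?I"
      by (intro CollectI exI[of _ "{a}"]) auto
  qed
  ultimately show "\<exists>F\<subseteq>A. finite F \<and> finite (x - \<Union>F)" if "x \<in> generated_ideal A"
    using that unfolding generated_ideal_def by blast
next
  assume "\<exists>F\<subseteq>A. finite F \<and> finite (x - \<Union>F)"
  then obtain F where F: "F \<subseteq> A" "finite F" "finite (x - \<Union>F)"
    by blast
  show "x \<in> generated_ideal A"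
    unfolding generated_ideal_def
  proof (intro InterI, elim CollectE conjE)
    fix I assume I: "ideal_on_omega I" "A \<subseteq> I"
    have un: "x \<union> y \<in> I" if "x \<in> I" "y \<in> I" for x y
      using I(1) that by (simp add: ideal_on_omega_def)
    have fin: "x \<in> I" if "finite x" for x
      using I(1) that by (simp add: ideal_on_omega_def)
    have "\<Union>F \<in> I"
      using F(2,1)
    proof (induction F)
      case empty
      show ?case using fin by simp
    next
      case (insert a F)
      then show ?case using un[of a "\<Union>F"] I(2) by auto
    qed
    then have "(x - \<Union>F) \<union> \<Union>F \<in> I"
      using un fin F(3) by blast
    moreover have "x \<subseteq> (x - \<Union>F) \<union> \<Union>F"
      by blast
    ultimately show "x \<in> I"
      using I(1) unfolding ideal_on_omega_def by blast
  qed
qed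

definition weakly_tight :: "nat set set \<Rightarrow> bool" where
  "weakly_tight A \<longleftrightarrow> almost_disjoint A \<and>
     (\<forall>b :: nat \<Rightarrow> nat set. range b \<subseteq> positive_sets A \<longrightarrow>
        (\<exists>a\<in>A. \<exists>\<^sub>\<infinity>n. infinite (b n \<inter> a)))"

end

theory Submission
  imports Defs
begin

text \<open>
  If \<open>|S| < \<bb>\<close> and no member of \<open>S\<close> splits the sequence \<open>(b\<^sub>n)\<close> in the
  \<open>\<omega>,\<omega>\<close>-sense, then a function dominating the moduli of this failure yields a single infinite set \<open>{x\<^sub>n}\<close>, \<open>x\<^sub>n \<in> b\<^sub>n\<close>, that no
  member of \<open>S\<close> splits; so a splitting family of size less than \<open>\<bb>\<close> is
  \<open>\<omega>,\<omega>\<close>-splitting.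

  The weakly tight family is built by recursion along all sequences \<open>(b\<^sub>n)\<close>, in the manner of
  Shelah's construction of completely separable families.  Well-order \<open>S\<close>; a node prescribes a side
  of every \<open>\<xi>\<close> in an initial segment of \<open>S\<close>.  Splitting a positive set repeatedly at the least
  place where both halves stay positive gives \<open>\<cc>\<close> many pairwise incompatible nodes, so one of them
  is not extended by any node used so far.  This gives infinite \<open>x\<^sub>n \<subseteq> b\<^sub>n\<close> that are almost
  disjoint from the family and lie on fresh nodes \<open>\<nu>\<^sub>n\<close>.  The same branching argument applied to
  the whole sequence gives \<open>c\<^sub>n \<subseteq> x\<^sub>n\<close> and a fresh node \<open>\<tau>\<close> to which the \<open>c\<^sub>n\<close> converge.  The
  new set is the union of the \<open>c\<^sub>n\<close> with finite parts removed.  Fewer than \<open>\<bb>\<close> earlier members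
  have a node below \<open>\<tau>\<close>, and domination takes care of them; the others are separated from the new
  set by incompatibility of nodes.
\<close>

lemma frequently_infinite_Un:
  assumes "\<exists>\<^sub>\<infinity>n. infinite (X n \<union> Y n)"
  shows "(\<exists>\<^sub>\<infinity>n. infinite (X n)) \<or> (\<exists>\<^sub>\<infinity>n. infinite (Y n))"
  using assms unfolding infinite_Un INFM_disj_distrib .

section \<open>Families of size less than the bounding number\<close>

lemma bounded_of_less_bounding_number:
  assumes "|I| <o \<bb>"
  shows "\<exists>g. \<forall>i\<in>I. f i \<le>\<^sup>* g"
proof (rule ccontr)
  assume "\<nexists>g. \<forall>i\<in>I. f i \<le>\<^sup>* g"
  then have "unbounded_family (f ` I)"
    by (simp add: unbounded_family_def)
  then have "\<bb> \<le>o |I|"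
    unfolding bounding_number_def by (rule least_size_indexed)
  then show False
    using assms not_ordLess_ordLeq by blast
qed

lemma finite_bounded: "finite F \<Longrightarrow> \<exists>g. \<forall>f\<in>F. f \<le>\<^sup>* g"
proof (induction F rule: finite_induct)
  case (insert f F)
  then obtain g where "\<forall>f\<in>F. f \<le>\<^sup>* g"
    by blast
  then have "\<forall>h\<in>insert f F. h \<le>\<^sup>* (\<lambda>n. max (f n) (g n))"
    unfolding eventually_le_def by (auto elim!: MOST_mono)
  then show ?case
    by blast
qed simp

lemma bounding_number_infinite: "\<exists>X. infinite X \<and> \<bb> = |X|"
proof -
  have "\<exists>X. unbounded_family X \<and> \<bb> = |X|"
    unfolding bounding_number_def by (rule least_size(1)) (use unbounded_family_UNIV in blast)
  then show ?thesis
    using finite_bounded unfolding unbounded_family_def by blast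
qed

lemma Un_less_bounding_number:
  assumes "|A| <o \<bb>" "|B| <o \<bb>"
  shows "|A \<union> B| <o \<bb>"
proof -
  obtain X :: "(nat \<Rightarrow> nat) set" where "infinite X" "\<bb> = |X|"
    using bounding_number_infinite by blast
  then show ?thesis
    using assms card_of_Un_ordLess_infinite[of X A B] by simp
qed

lemma finite_less_bounding_number: "finite A \<Longrightarrow> |A| <o \<bb>"
proof -
  assume "finite A"
  obtain X :: "(nat \<Rightarrow> nat) set" where "infinite X" "\<bb> = |X|"
    using bounding_number_infinite by blast
  moreover have "|A| <o |X|"
    by (rule finite_ordLess_infinite)
      (use \<open>finite A\<close> \<open>infinite X\<close> in \<open>simp_all add: card_of_well_order_on Field_card_of\<close>)
  ultimately show ?thesis
    by simp
qed

lemma subset_less_bounding_number: "A \<subseteq> B \<Longrightarrow> |B| <o \<bb> \<Longrightarrow> |A| <o \<bb>"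
  using card_of_mono1 ordLeq_ordLess_trans by blast

lemma image_less_bounding_number: "|A| <o \<bb> \<Longrightarrow> |f ` A| <o \<bb>"
  using card_of_image ordLeq_ordLess_trans by blast

text \<open>Each \<open>G\<close> yields a function bounding \<open>G \<inter> c n\<close>; one
  \<open>g\<close> dominates these fewer than \<open>\<bb>\<close> functions.\<close>

lemma almost_disjoint_bound:
  fixes c :: "nat \<Rightarrow> nat set"
  assumes "|\<G>| <o \<bb>" and fin: "\<forall>G\<in>\<G>. \<forall>\<^sub>\<infinity>n. finite (G \<inter> c n)"
  shows "\<exists>g :: nat \<Rightarrow> nat. \<forall>G\<in>\<G>. \<forall>\<^sub>\<infinity>n. G \<inter> c n \<subseteq> {..<g n}"
proof -
  \<comment> \<open>The value where \<open>G \<inter> c n\<close> is infinite is arbitrary; for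
    \<open>G \<in> \<G>\<close> this concerns only finitely many \<open>n\<close>.\<close>
  define f where "f G n = (SOME m. finite (G \<inter> c n) \<longrightarrow> G \<inter> c n \<subseteq> {..<m})" for G n
  have f: "G \<inter> c n \<subseteq> {..<f G n}" if "finite (G \<inter> c n)" for G n
    using someI_ex[of "\<lambda>m. finite (G \<inter> c n) \<longrightarrow> G \<inter> c n \<subseteq> {..<m}"] that finite_nat_bounded[OF that]
    unfolding f_def by blast
  obtain g where g: "\<forall>G\<in>\<G>. f G \<le>\<^sup>* g"
    using bounded_of_less_bounding_number[OF assms(1)] by blast
  have "\<forall>\<^sub>\<infinity>n. G \<inter> c n \<subseteq> {..<g n}" if "G \<in> \<G>" for G
  proof -
    have "\<forall>\<^sub>\<infinity>n. f G n \<le> g n"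
      using g that by (auto simp: eventually_le_def)
    then have "\<forall>\<^sub>\<infinity>n. f G n \<le> g n \<and> finite (G \<inter> c n)"
      using bspec[OF fin that] by (rule MOST_conjI)
    then show ?thesis
    proof (rule MOST_mono)
      fix n assume "f G n \<le> g n \<and> finite (G \<inter> c n)"
      then show "G \<inter> c n \<subseteq> {..<g n}"
        using f[of G n] by (meson lessThan_subset_iff order_trans)
    qed
  qed
  then show ?thesis
    by blast
qed

text \<open>Taking one point of each \<open>c n\<close> beyond the dominating bound
  \<open>g n\<close> leaves only finitely many points in any \<open>G \<in> \<G>\<close>.\<close>

lemma infinite_diagonal:
  fixes c :: "nat \<Rightarrow> nat set"
  assumes "|\<G>| <o \<bb>" and fin: "\<forall>G\<in>\<G>. \<forall>\<^sub>\<infinity>n. finite (G \<inter> c n)"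
    and inf: "\<And>n. infinite (c n)"
  shows "\<exists>x :: nat set. infinite x \<and> x \<subseteq> (\<Union>n. c n) \<and> (\<forall>G\<in>\<G>. finite (x \<inter> G))"
proof -
  obtain g where g: "\<And>G. G \<in> \<G> \<Longrightarrow> \<forall>\<^sub>\<infinity>n. G \<inter> c n \<subseteq> {..<g n}"
    using almost_disjoint_bound[OF assms(1) fin] by blast
  have "\<exists>x. \<forall>n. (x n \<in> c n \<and> g n < x n) \<and> x n < x (Suc n)"
  proof (rule dependent_nat_choice)
    show "\<exists>x. x \<in> c 0 \<and> g 0 < x"
      using inf[of 0] unfolding infinite_nat_iff_unbounded by blast
    show "\<exists>y. (y \<in> c (Suc n) \<and> g (Suc n) < y) \<and> x < y" for x n
    proof -
      obtain y where "y \<in> c (Suc n)" "max x (g (Suc n)) < y"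
        using inf[of "Suc n"] unfolding infinite_nat_iff_unbounded by blast
      then show ?thesis
        by auto
    qed
  qed
  then obtain x where x: "\<And>n. x n \<in> c n" "\<And>n. g n < x n" "\<And>n. x n < x (Suc n)"
    by blast
  then have "inj x"
    by (intro strict_mono_imp_inj_on) (simp add: strict_mono_Suc_iff)
  show ?thesis
  proof (intro exI conjI ballI)
    show "infinite (range x)"
      using \<open>inj x\<close> by (rule range_inj_infinite)
    show "range x \<subseteq> (\<Union>n. c n)"
      using x(1) by blast
    fix G assume "G \<in> \<G>"
    then have "\<forall>\<^sub>\<infinity>n. G \<inter> c n \<subseteq> {..<g n}"
      by (rule g)
    then have "\<forall>\<^sub>\<infinity>n. x n \<notin> G"
    proof (rule MOST_mono)
      fix n assume "G \<inter> c n \<subseteq> {..<g n}"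
      then show "x n \<notin> G"
        using x(1,2)[of n] by (meson IntI lessThan_iff less_asym subsetD)
    qed
    then have "finite (x ` {n. x n \<in> G})"
      unfolding MOST_iff_cofinite by simp
    then show "finite (range x \<inter> G)"
      by (rule finite_subset[rotated]) blast
  qed
qed

section \<open>Comparison of the two kinds of splitting families\<close>

lemma splitting_imp_omega_omega_splitting:
  assumes "splitting_family S" "|S| <o \<bb>"
  shows "omega_omega_splitting_family S"
  unfolding omega_omega_splitting_family_def
proof (intro conjI allI impI)
  show "S \<subseteq> inf_subsets"
    using assms(1) by (simp add: splitting_family_def)
  fix b :: "nat \<Rightarrow> nat set"
  assume b: "range b \<subseteq> inf_subsets"
  show "\<exists>e\<in>S. (\<exists>\<^sub>\<infinity>n. infinite (b n \<inter> e)) \<and> (\<exists>\<^sub>\<infinity>n. infinite (b n \<inter> - e))"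
  proof (rule ccontr)
    assume unsplit: "\<not> ?thesis"
    \<comment> \<open>If \<open>e\<close> fails to split the sequence, \<open>e\<close> or
      \<open>- e\<close> lies in \<open>\<G>\<close>; the diagonal set therefore almost misses one
      side of every \<open>e \<in> S\<close>.\<close>
    define \<G> where "\<G> = {G \<in> S \<union> uminus ` S. \<forall>\<^sub>\<infinity>n. finite (G \<inter> b n)}"
    have "|S \<union> uminus ` S| <o \<bb>"
      using assms(2) by (intro Un_less_bounding_number image_less_bounding_number)
    then have "|\<G>| <o \<bb>"
      by (rule subset_less_bounding_number[rotated]) (auto simp: \<G>_def)
    moreover have "\<forall>G\<in>\<G>. \<forall>\<^sub>\<infinity>n. finite (G \<inter> b n)"
      by (simp add: \<G>_def)
    moreover have "infinite (b n)" for n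
      using b by (auto simp: inf_subsets_def)
    ultimately obtain x where x: "infinite x" "\<And>G. G \<in> \<G> \<Longrightarrow> finite (x \<inter> G)"
      using infinite_diagonal[of \<G> b] by blast
    obtain e where e: "e \<in> S" "infinite (x \<inter> e)" "infinite (x \<inter> - e)"
      using assms(1) x(1) by (auto simp: splitting_family_def inf_subsets_def)
    have "(\<forall>\<^sub>\<infinity>n. finite (e \<inter> b n)) \<or> (\<forall>\<^sub>\<infinity>n. finite (- e \<inter> b n))"
      using unsplit e(1) by (auto simp: Int_commute)
    then have "e \<in> \<G> \<or> - e \<in> \<G>"
      using e(1) by (auto simp: \<G>_def)
    then show False
      using x(2) e by blast
  qed
qed

text \<open>Constant sequences suffice.\<close>

lemma omega_omega_splitting_imp_splitting:
  assumes "omega_omega_splitting_family S"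
  shows "splitting_family S"
  unfolding splitting_family_def
proof (intro conjI ballI)
  show "S \<subseteq> inf_subsets"
    using assms by (simp add: omega_omega_splitting_family_def)
  fix b assume "b \<in> inf_subsets"
  then have "\<exists>e\<in>S. (\<exists>\<^sub>\<infinity>n::nat. infinite (b \<inter> e)) \<and> (\<exists>\<^sub>\<infinity>n::nat. infinite (b \<inter> - e))"
    using assms unfolding omega_omega_splitting_family_def by (elim conjE allE[of _ "\<lambda>_. b"]) simp
  then show "\<exists>e\<in>S. infinite (b \<inter> e) \<and> infinite (b \<inter> - e)"
    by simp
qed

lemma splitting_number_attained: "\<exists>S. splitting_family S \<and> \<ss> = |S|"
  unfolding splitting_number_def
  by (rule least_size(1)) (use splitting_family_inf_subsets in blast)

lemma splitting_number_eq:
  assumes "\<ss> <o \<bb>"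
  shows "\<ss> =o \<ss>\<^sub>\<omega>\<^sub>\<omega>"
proof -
  have ex: "\<exists>S. omega_omega_splitting_family S" 
    using omega_omega_splitting_family_inf_subsets by blast
  obtain S where S: "splitting_family S" "\<ss> = |S|"
    using splitting_number_attained by blast
  obtain S' where S': "omega_omega_splitting_family S'" "\<ss>\<^sub>\<omega>\<^sub>\<omega> = |S'|"
    using least_size(1)[OF ex] unfolding omega_omega_splitting_number_def by blast
  have "\<ss> \<le>o \<ss>\<^sub>\<omega>\<^sub>\<omega>"
    unfolding S'(2) unfolding splitting_number_def
    by (rule least_size(2)) (use S'(1) omega_omega_splitting_imp_splitting in blast)+
  moreover have "\<ss>\<^sub>\<omega>\<^sub>\<omega> \<le>o \<ss>"
    unfolding S(2) unfolding omega_omega_splitting_number_def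
    by (rule least_size(2)[OF ex]) (use S assms splitting_imp_omega_omega_splitting in simp)
  ultimately show ?thesis
    by (simp add: ordIso_iff_ordLeq)
qed

section \<open>The branching argument\<close>

definition side :: "bool \<Rightarrow> 'a set \<Rightarrow> 'a set" where
  "side i A = (if i then A else - A)"

lemma side_simps [simp]: "side True A = A" "side False A = - A"
  by (simp_all add: side_def)

lemma Int_side_Un: "(X \<inter> side i A) \<union> (X \<inter> side (\<not> i) A) = X"
  by (cases i) auto

lemma side_disjoint: "side i A \<inter> side (\<not> i) A = {}"
  by (cases i) auto

text \<open>
  Here \<open>P\<close> is a coideal in which decreasing sequences have pseudo-intersections.  The set of places
  where a \<open>P\<close>-set \<open>X\<close> is split into two \<open>P\<close>-sets shrinks with \<open>X\<close>; the nodes \<open>\<tau> f\<close>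
  belonging to two branches \<open>f\<close>, \<open>g\<close> differ at the least such place for the set reached when the
  branches separate.
\<close>

lemma fresh_branch:
  fixes E :: "'i \<Rightarrow> 'b set" and r :: "'i rel" and M :: "('i \<Rightarrow> bool option) set"
  assumes r: "Well_order r"
    and P_mono: "\<And>X Y. P X \<Longrightarrow> X \<subseteq> Y \<Longrightarrow> P Y"
    and P_Un: "\<And>X Y. P (X \<union> Y) \<Longrightarrow> P X \<or> P Y"
    and P_empty: "\<not> P {}"
    and P_split: "\<And>X. P X \<Longrightarrow> \<exists>\<xi>\<in>Field r. P (X \<inter> E \<xi>) \<and> P (X \<inter> - E \<xi>)"
    and P_pseudo: "\<And>C :: nat \<Rightarrow> 'b set. (\<And>n. P (C n)) \<Longrightarrow> antimono C \<Longrightarrow> \<exists>X. P X \<and> (\<forall>n. \<not> P (X - C n))"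
    and X0: "P X0" and M: "|M| <o |UNIV :: nat set set|"
  shows "\<exists>\<tau> C. C \<subseteq> X0 \<and> P C \<and> ofilter r (dom \<tau>) \<and> (\<forall>\<nu>\<in>M. \<not> \<tau> \<subseteq>\<^sub>m \<nu>) \<and>
    (\<forall>\<xi> i. \<tau> \<xi> = Some i \<longrightarrow> \<not> P (C \<inter> side (\<not> i) (E \<xi>)))"
proof -
  interpret wo_rel r
    using r by (simp add: wo_rel_def)
  define L where "L X = {\<xi> \<in> Field r. P (X \<inter> E \<xi>) \<and> P (X \<inter> - E \<xi>)}" for X
  define \<alpha> where "\<alpha> X = minim (L X)" for X
  have L_Field: "L X \<subseteq> Field r" for X
    by (auto simp: L_def)
  have L_mono: "L X \<subseteq> L Y" if "X \<subseteq> Y" for X Y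
    unfolding L_def using that P_mono by (auto intro: P_mono)
  have \<alpha>_in: "\<alpha> X \<in> L X" if "P X" for X
    unfolding \<alpha>_def using P_split[OF that] by (intro minim_in L_Field) (auto simp: L_def)
  have \<alpha>_least: "(\<alpha> X, \<xi>) \<in> r" if "\<xi> \<in> L X" for \<xi> X
    unfolding \<alpha>_def using that by (intro minim_least L_Field)
  \<comment> \<open>Subsets \<open>f\<close> of \<omega> index the branches: step \<open>n\<close>
    cuts the current set at its least splitting place and keeps the half named by
    \<open>n \<in> f\<close>.\<close>
  define C where "C f = rec_nat X0 (\<lambda>n X. X \<inter> side (n \<in> f) (E (\<alpha> X)))" for f :: "nat set"
  have C_0: "C f 0 = X0" and C_Suc: "C f (Suc n) = C f n \<inter> side (n \<in> f) (E (\<alpha> (C f n)))" for f n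
    by (simp_all add: C_def)
  have PC: "P (C f n)" for f n
  proof (induction n)
    case (Suc n)
    then show ?case
      using \<alpha>_in[OF Suc] by (cases "n \<in> f") (auto simp: C_Suc L_def)
  qed (simp add: C_0 X0)
  have C_dec: "antimono (C f)" for f
    by (simp add: antimono_iff_le_Suc C_Suc)
  have C_mono: "C f n \<subseteq> C f m" if "m \<le> n" for f m n
    using antimonoD[OF C_dec that] .
  \<comment> \<open>After the cut one half at that place is empty for good. Since \<open>L\<close>
    shrinks along the branch, the least splitting places increase strictly.\<close>
  have \<alpha>_notin: "\<alpha> (C f n) \<notin> L (C f m)" if "n < m" for f n m
  proof -
    have "C f m \<subseteq> side (n \<in> f) (E (\<alpha> (C f n)))"
      using C_mono[OF Suc_leI[OF that], of f] unfolding C_Suc by blast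
    then have "C f m \<inter> side (\<not> n \<in> f) (E (\<alpha> (C f n))) = {}"
      using side_disjoint[of "n \<in> f" "E (\<alpha> (C f n))"] by blast
    then show ?thesis
      using P_empty by (cases "n \<in> f") (auto simp: L_def)
  qed
  have \<alpha>_less: "\<alpha> (C f n) \<in> underS (\<alpha> (C f m))" if "n < m" for f n m
  proof -
    have *: "\<alpha> (C f m) \<in> L (C f m)"
      using PC by (rule \<alpha>_in)
    then have "(\<alpha> (C f n), \<alpha> (C f m)) \<in> r"
      by (intro \<alpha>_least subsetD[OF L_mono[OF C_mono[OF less_imp_le[OF that]]]])
    moreover have "\<alpha> (C f n) \<noteq> \<alpha> (C f m)"
      using * \<alpha>_notin[OF that, of f] by auto
    ultimately show ?thesis
      by (simp add: underS_def)
  qed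
  have not_in_L: "\<xi> \<notin> L X" if "\<xi> \<in> underS (\<alpha> X)" for \<xi> X
    using \<alpha>_least[of \<xi> X] that ANTISYM unfolding underS_def antisym_def by blast
  \<comment> \<open>Below \<open>\<alpha> (C f n)\<close> the set \<open>C f n\<close> is split
    nowhere, so at every \<open>\<xi> \<in> U f\<close> one side eventually fails \<open>P\<close>;
    \<open>\<tau> f \<xi>\<close> records the other.\<close>
  define U where "U f = (\<Union>n. underS (\<alpha> (C f n)))" for f
  define \<tau> where "\<tau> f \<xi> = (if \<xi> \<in> U f then Some (\<forall>n. P (C f n \<inter> E \<xi>)) else None)" for f \<xi>
  have dom_\<tau>: "dom (\<tau> f) = U f" for f
    by (auto simp: \<tau>_def dom_def)
  have small_side: "\<exists>n. \<not> P (C f n \<inter> side (\<not> i) (E \<xi>))" if "\<tau> f \<xi> = Some i" for f \<xi> i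
  proof (cases i)
    case True
    then have all: "P (C f n \<inter> E \<xi>)" for n
      using that by (auto simp: \<tau>_def split: if_splits)
    have "\<xi> \<in> U f"
      using that by (simp add: \<tau>_def split: if_splits)
    then obtain n where n: "\<xi> \<in> underS (\<alpha> (C f n))"
      by (auto simp: U_def)
    then have "\<xi> \<in> Field r"
      by (auto simp: underS_def Field_def)
    then have "\<not> P (C f n \<inter> - E \<xi>)"
      using not_in_L[OF n] all[of n] by (simp add: L_def)
    then show ?thesis
      using True by auto
  next
    case False
    then show ?thesis
      using that by (auto simp: \<tau>_def split: if_splits)
  qed
  \<comment> \<open>At the splitting places the node copies \<open>f\<close> itself.\<close>
  have \<tau>_\<alpha>: "\<tau> f (\<alpha> (C f n)) = Some (n \<in> f)" for f n
  proof -
    have "\<alpha> (C f n) \<in> U f"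
      using \<alpha>_less[of n "Suc n" f] by (auto simp: U_def)
    moreover have "(\<forall>m. P (C f m \<inter> E (\<alpha> (C f n)))) \<longleftrightarrow> n \<in> f"
    proof (cases "n \<in> f")
      case True
      have "P (C f m \<inter> E (\<alpha> (C f n)))" for m
      proof (rule P_mono[OF PC[of f "max m (Suc n)"]])
        show "C f (max m (Suc n)) \<subseteq> C f m \<inter> E (\<alpha> (C f n))"
          using C_mono[OF max.cobounded1[of m "Suc n"], of f] C_mono[OF max.cobounded2[of "Suc n" m], of f] True
          unfolding C_Suc by auto
      qed
      then show ?thesis
        using True by simp
    next
      case False
      then have "C f (Suc n) \<inter> E (\<alpha> (C f n)) = {}"
        by (auto simp: C_Suc)
      then show ?thesis
        using False P_empty by metis
    qed
    ultimately show ?thesis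
      by (simp add: \<tau>_def)
  qed
  have incompatible: False if fg: "f \<noteq> g" and \<nu>: "\<tau> f \<subseteq>\<^sub>m \<nu>" "\<tau> g \<subseteq>\<^sub>m \<nu>" for f g \<nu>
  proof -
    \<comment> \<open>Up to the least difference the branches pass through the same sets, so they
      share the place \<open>\<alpha> (C f n)\<close> and take opposite sides there.\<close>
    define n where "n = (LEAST n. (n \<in> f) \<noteq> (n \<in> g))"
    have n: "(n \<in> f) \<noteq> (n \<in> g)"
      unfolding n_def by (rule LeastI_ex) (use fg in blast)
    have "(m \<in> f) = (m \<in> g)" if "m < n" for m
      using not_less_Least[of m "\<lambda>n. (n \<in> f) \<noteq> (n \<in> g)"] that by (simp add: n_def)
    then have "m \<le> n \<Longrightarrow> C f m = C g m" for m
      by (induction m) (auto simp: C_0 C_Suc)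
    then have eq: "C f n = C g n"
      by simp
    have "\<nu> (\<alpha> (C f n)) = Some (n \<in> f)"
      using \<nu>(1) \<tau>_\<alpha>[of f n] unfolding map_le_def by (metis domI)
    moreover have "\<nu> (\<alpha> (C g n)) = Some (n \<in> g)"
      using \<nu>(2) \<tau>_\<alpha>[of g n] unfolding map_le_def by (metis domI)
    ultimately show False
      using n eq by simp
  qed
  obtain f where f: "\<forall>\<nu>\<in>M. \<not> \<tau> f \<subseteq>\<^sub>m \<nu>"
  proof (rule ccontr)
    assume "\<not> thesis"
    then have "\<forall>f. \<exists>\<nu>\<in>M. \<tau> f \<subseteq>\<^sub>m \<nu>"
      using that by blast
    then obtain h where h: "\<And>f. h f \<in> M" "\<And>f. \<tau> f \<subseteq>\<^sub>m h f"
      by metis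
    have "inj h"
      using h(2) incompatible by (metis injI)
    then have "|UNIV :: nat set set| \<le>o |M|"
      using h(1) card_of_ordLeq[of "UNIV :: nat set set" M] by blast
    then show False
      using M not_ordLess_ordLeq by blast
  qed
  \<comment> \<open>The failures of \<open>P\<close> from \<open>small_side\<close> occur at
    different stages; a pseudo-intersection inherits them all. Intersecting it with
    \<open>X0\<close> removes only \<open>X - C f 0\<close>, which fails \<open>P\<close>.\<close>
  obtain X where X: "P X" "\<And>n. \<not> P (X - C f n)"
    using P_pseudo[of "C f"] PC C_dec by blast
  show ?thesis
  proof (intro exI conjI allI impI)
    show "X \<inter> X0 \<subseteq> X0"
      by simp
    show "P (X \<inter> X0)"
      using P_Un[of "X \<inter> X0" "X - X0"] X(1) X(2)[of 0] by (simp add: C_0 Int_Diff_Un)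
    show "ofilter (dom (\<tau> f))"
      unfolding dom_\<tau> U_def by (intro ofilter_UNION underS_ofilter)
    show "\<forall>\<nu>\<in>M. \<not> \<tau> f \<subseteq>\<^sub>m \<nu>"
      by (rule f)
    fix \<xi> i assume "\<tau> f \<xi> = Some i"
    then obtain n where n: "\<not> P (C f n \<inter> side (\<not> i) (E \<xi>))"
      using small_side by blast
    have "X \<inter> X0 \<inter> side (\<not> i) (E \<xi>) \<subseteq> (X - C f n) \<union> (C f n \<inter> side (\<not> i) (E \<xi>))"
      by blast
    then show "\<not> P (X \<inter> X0 \<inter> side (\<not> i) (E \<xi>))"
      using P_mono P_Un X(2) n by blast
  qed
qed

section \<open>Positive sets of an almost disjoint family\<close>

lemma positive_sets_iff: "x \<in> positive_sets A \<longleftrightarrow> (\<forall>F\<subseteq>A. finite F \<longrightarrow> infinite (x - \<Union>F))"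
  by (auto simp: positive_sets_def generated_ideal_iff)

lemma positive_sets_anti: "A \<subseteq> B \<Longrightarrow> positive_sets B \<subseteq> positive_sets A"
  by (auto simp: positive_sets_iff)

lemma positive_sets_mono: "x \<in> positive_sets A \<Longrightarrow> x \<subseteq> y \<Longrightarrow> y \<in> positive_sets A"
  unfolding positive_sets_iff by (meson Diff_mono infinite_super order_refl)

lemma positive_sets_Un:
  assumes "x \<union> y \<in> positive_sets A"
  shows "x \<in> positive_sets A \<or> y \<in> positive_sets A"
proof (rule ccontr)
  assume "\<not> ?thesis"
  then obtain F G where *: "F \<subseteq> A" "finite F" "finite (x - \<Union>F)" "G \<subseteq> A" "finite G" "finite (y - \<Union>G)"
    unfolding positive_sets_iff by blast
  have "finite (x \<union> y - \<Union>(F \<union> G))"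
    by (rule finite_subset[of _ "(x - \<Union>F) \<union> (y - \<Union>G)"]) (use * in auto)
  then show False
    using assms * unfolding positive_sets_iff by (metis Un_least finite_UnI)
qed

lemma positive_sets_infinite: "x \<in> positive_sets A \<Longrightarrow> infinite x"
  unfolding positive_sets_iff by (metis Diff_empty Union_empty empty_subsetI finite.emptyI)

lemma positive_if_orthogonal:
  assumes "infinite x" "\<forall>a\<in>A. finite (x \<inter> a)"
  shows "x \<in> positive_sets A"
  unfolding positive_sets_iff
proof (intro allI impI)
  fix F assume F: "F \<subseteq> A" "finite F"
  have "finite (\<Union>a\<in>F. x \<inter> a)"
    using F assms(2) by (intro finite_UN_I) auto
  moreover have "x = (\<Union>a\<in>F. x \<inter> a) \<union> (x - \<Union>F)"
    by blast
  ultimately show "infinite (x - \<Union>F)"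
    using assms(1) by (metis finite_UnI)
qed

text \<open>A finite subfamily almost covering \<open>x\<close> would almost cover
  \<open>x \<inter> a\<close> for a member \<open>a\<close> outside it with
  \<open>x \<inter> a\<close> infinite, yet \<open>a\<close> meets each of its members
  finitely.\<close>

lemma positive_if_meets_infinitely_many:
  assumes "almost_disjoint A" and inf: "infinite {a \<in> A. infinite (x \<inter> a)}"
  shows "x \<in> positive_sets A"
  unfolding positive_sets_iff
proof (intro allI impI notI)
  fix F assume F: "F \<subseteq> A" "finite F" "finite (x - \<Union>F)"
  obtain a where a: "a \<in> A" "infinite (x \<inter> a)" "a \<notin> F"
    using Diff_infinite_finite[OF F(2) inf] infinite_imp_nonempty by blast
  have "finite (\<Union>a'\<in>F. a \<inter> a')"
  proof (rule finite_UN_I[OF F(2)])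
    fix a' assume "a' \<in> F"
    then have "a' \<in> A" "a \<noteq> a'"
      using F(1) a(3) by auto
    then show "finite (a \<inter> a')"
      using a(1) assms(1) by (simp add: almost_disjoint_def)
  qed
  moreover have "x \<inter> a \<subseteq> (\<Union>a'\<in>F. a \<inter> a') \<union> (x - \<Union>F)"
    by blast
  ultimately show False
    using a(2) F(3) finite_subset by blast
qed

text \<open>If only finitely many members meet \<open>x\<close> infinitely, removing their union
  leaves an orthogonal set; otherwise countably many of them are selected.\<close>

lemma positive_orthogonal_or_sequence:
  assumes "x \<in> positive_sets A"
  obtains (orthogonal) y where "y \<subseteq> x" "infinite y" "\<forall>a\<in>A. finite (y \<inter> a)"
  | (sequence) a :: "nat \<Rightarrow> nat set" where "inj a" "range a \<subseteq> A" "\<And>n. infinite (x \<inter> a n)"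
proof (cases "finite {a \<in> A. infinite (x \<inter> a)}")
  case True
  let ?T = "{a \<in> A. infinite (x \<inter> a)}"
  have "infinite (x - \<Union>?T)"
    using assms True unfolding positive_sets_iff by (elim allE[of _ ?T]) auto
  moreover have "finite ((x - \<Union>?T) \<inter> a)" if "a \<in> A" for a
  proof (cases "a \<in> ?T")
    case True
    then have "(x - \<Union>?T) \<inter> a = {}"
      by blast
    then show ?thesis
      by (metis finite.emptyI)
  next
    case False
    then show ?thesis
      using that by (auto intro: finite_subset[of _ "x \<inter> a"])
  qed
  ultimately show thesis
    by (intro orthogonal[of "x - \<Union>?T"]) auto
next
  case False
  then obtain a :: "nat \<Rightarrow> nat set" where "inj a" "range a \<subseteq> {a \<in> A. infinite (x \<inter> a)}"
    using infinite_countable_subset by blast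
  then show thesis
    by (intro sequence[of a]) auto
qed

lemma positive_if_meets_sequence:
  assumes "almost_disjoint A" "inj a" "range a \<subseteq> A" "\<exists>\<^sub>\<infinity>n::nat. infinite (x \<inter> a n)"
  shows "x \<in> positive_sets A"
proof (rule positive_if_meets_infinitely_many[OF assms(1)])
  have "infinite (a ` {n. infinite (x \<inter> a n)})"
    using assms(2,4) by (simp add: INFM_iff_infinite finite_image_iff inj_on_subset)
  then show "infinite {a \<in> A. infinite (x \<inter> a)}"
    by (rule infinite_super[rotated]) (use assms(3) in auto)
qed

text \<open>In the orthogonal case it suffices to split \<open>y\<close>. Otherwise the sequence
  \<open>x \<inter> a n\<close> is split: each half meets infinitely many \<open>a n\<close>
  infinitely and so is positive.\<close>

lemma positive_split:
  assumes S: "omega_omega_splitting_family S" and A: "almost_disjoint A" and x: "x \<in> positive_sets A"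
  shows "\<exists>e\<in>S. x \<inter> e \<in> positive_sets A \<and> x \<inter> - e \<in> positive_sets A"
  using x
proof (cases rule: positive_orthogonal_or_sequence)
  case (orthogonal y)
  then obtain e where e: "e \<in> S" "infinite (y \<inter> e)" "infinite (y \<inter> - e)"
    using omega_omega_splitting_imp_splitting[OF S] by (auto simp: splitting_family_def inf_subsets_def)
  have "y \<inter> z \<in> positive_sets A" if "infinite (y \<inter> z)" for z
    using that orthogonal(3) by (auto intro!: positive_if_orthogonal intro: finite_subset[of _ "y \<inter> _"])
  then show ?thesis
    using e orthogonal(1) by (intro bexI[of _ e] conjI) (auto intro: positive_sets_mono[of "y \<inter> _"])
next
  case (sequence a)
  then have "range (\<lambda>n. x \<inter> a n) \<subseteq> inf_subsets"
    by (auto simp: inf_subsets_def)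
  then obtain e where e: "e \<in> S" "\<exists>\<^sub>\<infinity>n. infinite (x \<inter> a n \<inter> e)" "\<exists>\<^sub>\<infinity>n. infinite (x \<inter> a n \<inter> - e)"
    using S unfolding omega_omega_splitting_family_def by meson
  have "x \<inter> z \<in> positive_sets A" if "\<exists>\<^sub>\<infinity>n. infinite (x \<inter> a n \<inter> z)" for z
    using that by (intro positive_if_meets_sequence[OF A sequence(1,2)]) (simp add: Int_ac)
  then show ?thesis
    using e by blast
qed

lemma positive_pseudo_intersection:
  assumes A: "almost_disjoint A" and pos: "\<And>n. C n \<in> positive_sets A" and C: "antimono C"
  shows "\<exists>x \<in> positive_sets A. \<forall>n::nat. finite (x - C n)"
proof -
  \<comment> \<open>\<open>T\<close> collects the members containing an infinite pseudo-intersection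
    of \<open>C\<close>. If it is finite, a diagonal sequence off \<open>\<Union>T\<close> is
    orthogonal to \<open>A\<close>, since a member meeting it infinitely would lie in
    \<open>T\<close>. If it is infinite, pseudo-intersections inside distinct members are
    glued.\<close>
  define T where "T = {a \<in> A. \<exists>y\<subseteq>a. infinite y \<and> (\<forall>n. finite (y - C n))}"
  show ?thesis
  proof (cases "finite T")
    case True
    have inf: "infinite (C n - \<Union>T)" for n
      using pos[of n] True unfolding positive_sets_iff by (elim allE[of _ T]) (auto simp: T_def)
    have "\<exists>y. \<forall>n. y n \<in> C n - \<Union>T \<and> y n < y (Suc n)"
    proof (rule dependent_nat_choice)
      show "\<exists>y. y \<in> C 0 - \<Union>T"
        using inf[of 0] infinite_imp_nonempty by blast
      show "\<exists>z. z \<in> C (Suc n) - \<Union>T \<and> y < z" for y n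
        using inf[of "Suc n"] unfolding infinite_nat_iff_unbounded by blast
    qed
    then obtain y where y: "\<And>n. y n \<in> C n - \<Union>T" "\<And>n. y n < y (Suc n)"
      by blast
    then have "inj y"
      by (intro strict_mono_imp_inj_on) (simp add: strict_mono_Suc_iff)
    then have inf_y: "infinite (range y)"
      by (rule range_inj_infinite)
    have fin: "finite (range y - C n)" for n
    proof (rule finite_subset)
      show "range y - C n \<subseteq> y ` {..<n}"
      proof
        fix z assume "z \<in> range y - C n"
        then obtain k where k: "z = y k" "y k \<notin> C n"
          by blast
        then have "\<not> n \<le> k"
          using y(1)[of k] antimonoD[OF C, of n k] by blast
        then show "z \<in> y ` {..<n}"
          using k(1) by simp
      qed
    qed simp
    have "finite (range y \<inter> a)" if "a \<in> A" for a
    proof (rule ccontr)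
      assume inf_a: "infinite (range y \<inter> a)"
      have "finite (range y \<inter> a - C n)" for n
        by (rule finite_subset[OF _ fin[of n]]) blast
      then have "a \<in> T"
        using that inf_a unfolding T_def by blast
      then have "range y \<inter> a = {}"
        using y(1) by blast
      then show False
        using inf_a by simp
    qed
    then have "range y \<in> positive_sets A"
      using inf_y by (intro positive_if_orthogonal) blast+
    then show ?thesis
      using fin by blast
  next
    case False
    then obtain a :: "nat \<Rightarrow> nat set" where a: "inj a" "range a \<subseteq> T"
      using infinite_countable_subset by blast
    have "\<forall>i. \<exists>y\<subseteq>a i. infinite y \<and> (\<forall>n. finite (y - C n))"
      using a(2) by (auto simp: T_def)
    then obtain y where y: "\<And>i. y i \<subseteq> a i" "\<And>i. infinite (y i)" "\<And>i n. finite (y i - C n)"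
      by metis
    \<comment> \<open>Cutting \<open>y i\<close> down to \<open>C i\<close> confines
      \<open>x - C n\<close> to the pieces with \<open>i < n\<close>, each almost contained in
      \<open>C n\<close>.\<close>
    define x where "x = (\<Union>i. y i \<inter> C i)"
    have "infinite (x \<inter> a i)" for i
    proof -
      have "infinite (y i \<inter> C i)"
        using y(2,3)[of i] by (metis Int_Diff_Un finite_UnI)
      moreover have "y i \<inter> C i \<subseteq> x \<inter> a i"
        using y(1) by (auto simp: x_def)
      ultimately show ?thesis
        using finite_subset by blast
    qed
    then have "x \<in> positive_sets A"
      using a by (intro positive_if_meets_sequence[OF A a(1)]) (auto simp: T_def)
    moreover have "finite (x - C n)" for n
    proof (rule finite_subset)
      show "x - C n \<subseteq> (\<Union>i<n. y i - C n)"
      proof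
        fix z assume "z \<in> x - C n"
        then obtain i where i: "z \<in> y i" "z \<in> C i" "z \<notin> C n"
          by (auto simp: x_def)
        then have "\<not> n \<le> i"
          using antimonoD[OF C, of n i] by blast
        then show "z \<in> (\<Union>i<n. y i - C n)"
          using i by auto
      qed
      show "finite (\<Union>i<n. y i - C n)"
        using y(3) by blast
    qed
    ultimately show ?thesis
      by blast
  qed
qed

text \<open>In the sequence case \<open>G\<close> is almost covered by finitely many members, so
  almost every \<open>x \<inter> a n\<close> meets it finitely and \<open>infinite_diagonal\<close>
  applies.\<close>

lemma positive_diagonal:
  assumes A: "almost_disjoint A" and x: "x \<in> positive_sets A"
    and \<G>: "\<G> \<subseteq> generated_ideal A" "|\<G>| <o \<bb>"
  shows "\<exists>y\<subseteq>x. infinite y \<and> (\<forall>G\<in>\<G>. finite (y \<inter> G))"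
  using x
proof (cases rule: positive_orthogonal_or_sequence)
  case (orthogonal y)
  have "finite (y \<inter> G)" if "G \<in> \<G>" for G
  proof -
    obtain F where F: "F \<subseteq> A" "finite F" "finite (G - \<Union>F)"
      using subsetD[OF \<G>(1) \<open>G \<in> \<G>\<close>] unfolding generated_ideal_iff by blast
    have "finite ((\<Union>a\<in>F. y \<inter> a) \<union> (G - \<Union>F))"
      using F orthogonal(3) by blast
    then show ?thesis
      by (rule finite_subset[rotated]) blast
  qed
  then show ?thesis
    using orthogonal by blast
next
  case (sequence a)
  have "\<forall>\<^sub>\<infinity>n. finite (G \<inter> (x \<inter> a n))" if "G \<in> \<G>" for G
  proof -
    obtain F where F: "F \<subseteq> A" "finite F" "finite (G - \<Union>F)"
      using subsetD[OF \<G>(1) \<open>G \<in> \<G>\<close>] unfolding generated_ideal_iff by blast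
    have "finite (G \<inter> (x \<inter> a n))" if "a n \<notin> F" for n
    proof -
      have "finite ((\<Union>a'\<in>F. a n \<inter> a') \<union> (G - \<Union>F))"
      proof (intro finite_UnI finite_UN_I F(2,3))
        fix a' assume "a' \<in> F"
        then have "a' \<in> A" "a n \<noteq> a'" "a n \<in> A"
          using F(1) that sequence(2) by auto
        then show "finite (a n \<inter> a')"
          using A by (simp add: almost_disjoint_def)
      qed
      then show ?thesis
        by (rule finite_subset[rotated]) blast
    qed
    moreover have "finite {n. a n \<in> F}"
      using finite_vimageI[OF F(2) sequence(1)] by (simp add: vimage_def)
    ultimately show ?thesis
      unfolding MOST_iff_cofinite by (auto intro: finite_subset[of _ "{n. a n \<in> F}"])
  qed
  then have "\<exists>y. infinite y \<and> y \<subseteq> (\<Union>n. x \<inter> a n) \<and> (\<forall>G\<in>\<G>. finite (y \<inter> G))"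
    using sequence(3) by (intro infinite_diagonal[OF \<G>(2)]) auto
  then show ?thesis
    by blast
qed

section \<open>Nodes\<close>

text \<open>The finite terms are skipped by enumerating the indices of the infinite ones.\<close>

lemma omega_omega_splitting_frequently:
  fixes c :: "nat \<Rightarrow> nat set"
  assumes S: "omega_omega_splitting_family S" and "\<exists>\<^sub>\<infinity>n. infinite (c n)"
  shows "\<exists>e\<in>S. (\<exists>\<^sub>\<infinity>n. infinite (c n \<inter> e)) \<and> (\<exists>\<^sub>\<infinity>n. infinite (c n \<inter> - e))"
proof -
  have inf: "infinite {n. infinite (c n)}"
    using assms(2) by (simp add: INFM_iff_infinite)
  define u where "u = enumerate {n. infinite (c n)}"
  have u: "inj u" "\<And>k. infinite (c (u k))"
    using enumerate_in_set[OF inf] strict_mono_enumerate[OF inf]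
    by (auto simp: u_def intro: strict_mono_imp_inj_on)
  then have "range (\<lambda>k. c (u k)) \<subseteq> inf_subsets"
    by (auto simp: inf_subsets_def)
  then obtain e where "e \<in> S" "\<exists>\<^sub>\<infinity>k. infinite (c (u k) \<inter> e)" "\<exists>\<^sub>\<infinity>k. infinite (c (u k) \<inter> - e)"
    using S unfolding omega_omega_splitting_family_def by meson
  then show ?thesis
    using INFM_inj[OF _ u(1)] by (intro bexI[of _ e] conjI)
qed

type_synonym node = "nat set \<Rightarrow> bool option"

text \<open>
  A member \<open>a\<close> of the family comes with a countable set \<open>N\<close> of nodes, namely \<open>\<tau>\<close> and all
  \<open>\<nu>\<^sub>n\<close>.  The following consequence is all that is needed to see that a set almost contained
  in the sides of a node incompatible with every node in \<open>N\<close> is almost disjoint from \<open>a\<close>.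
\<close>

definition carried_by :: "nat set \<Rightarrow> node set \<Rightarrow> bool" where
  "carried_by a N \<longleftrightarrow> (\<forall>x\<subseteq>a. (\<forall>\<nu>\<in>N. \<exists>\<xi> i. \<nu> \<xi> = Some i \<and> finite (x \<inter> side i \<xi>)) \<longrightarrow> finite x)"

locale small_splitting =
  fixes S :: "nat set set"
  assumes splitting: "splitting_family S" and less_b: "|S| <o \<bb>"
begin

lemma omega_omega_splitting: "omega_omega_splitting_family S"
  using splitting less_b by (rule splitting_imp_omega_omega_splitting)

sublocale wo_rel "|S|"
  by (simp add: wo_rel_def card_of_well_order_on Field_card_of)

abbreviation is_node :: "node \<Rightarrow> bool" where
  "is_node \<nu> \<equiv> ofilter (dom \<nu>)"

lemma dom_node: "is_node \<nu> \<Longrightarrow> dom \<nu> \<subseteq> S"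
  by (simp add: ofilter_def Field_card_of)

text \<open>A node below \<open>\<tau>\<close> is determined by its domain, and the initial segments
  are \<open>S\<close> and the sets \<open>underS \<xi>\<close>.\<close>

lemma initial_nodes_less_b: "|{\<nu>. is_node \<nu> \<and> \<nu> \<subseteq>\<^sub>m \<tau>}| <o \<bb>"
proof -
  let ?I = "{\<nu>. is_node \<nu> \<and> \<nu> \<subseteq>\<^sub>m \<tau>}"
  have restrict: "\<nu> = \<tau> |` dom \<nu>" if "\<nu> \<subseteq>\<^sub>m \<tau>" for \<nu>
  proof
    fix \<xi> show "\<nu> \<xi> = (\<tau> |` dom \<nu>) \<xi>"
      using that by (cases "\<xi> \<in> dom \<nu>") (auto simp: map_le_def restrict_map_def domIff)
  qed
  have "inj_on dom ?I"
    by (rule inj_onI) (use restrict in \<open>metis (no_types, lifting) mem_Collect_eq\<close>)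
  moreover have "dom ` ?I \<subseteq> {S} \<union> underS ` S"
    using ofilter_underS_Field by (auto simp: Field_card_of)
  ultimately have "|?I| \<le>o |{S} \<union> underS ` S|"
    using card_of_ordLeq by blast
  moreover have "|{S} \<union> underS ` S| <o \<bb>"
    by (intro Un_less_bounding_number finite_less_bounding_number image_less_bounding_number less_b) simp
  ultimately show ?thesis
    by (rule ordLeq_ordLess_trans)
qed

text \<open>The domains are nested initial segments, so nodes that do not extend one another
  disagree on the smaller domain.\<close>

lemma incompatible_nodes:
  assumes "is_node \<nu>" "is_node \<tau>" "\<not> \<nu> \<subseteq>\<^sub>m \<tau>" "\<not> \<tau> \<subseteq>\<^sub>m \<nu>"
  shows "\<exists>\<xi> i. \<nu> \<xi> = Some i \<and> \<tau> \<xi> = Some (\<not> i)"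
proof -
  have "\<exists>\<xi>. \<xi> \<in> dom \<nu> \<and> \<xi> \<in> dom \<tau> \<and> \<nu> \<xi> \<noteq> \<tau> \<xi>"
    using ofilter_linord[OF assms(1,2)] assms(3,4) by (auto simp: map_le_def) (metis domI option.inject subsetD)+
  then obtain \<xi> i j where "\<nu> \<xi> = Some i" "\<tau> \<xi> = Some j" "i \<noteq> j"
    by auto
  then show ?thesis
    by (intro exI[of _ \<xi>] exI[of _ i]) auto
qed

text \<open>The invariant of the recursion. Disjoint node sets let a node identify its pair; their
  countability keeps the nodes used before any stage fewer than \<open>\<cc>\<close>.\<close>

definition coherent :: "(nat set \<times> node set) set \<Rightarrow> bool" where
  "coherent W \<longleftrightarrow>
    (\<forall>p\<in>W. infinite (fst p) \<and> carried_by (fst p) (snd p) \<and> |snd p| \<le>o |UNIV :: nat set| \<and> (\<forall>\<nu>\<in>snd p. is_node \<nu>)) \<and>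
    (\<forall>p\<in>W. \<forall>q\<in>W. p \<noteq> q \<longrightarrow> finite (fst p \<inter> fst q) \<and> snd p \<inter> snd q = {})"

lemma coherent_almost_disjoint: "coherent W \<Longrightarrow> almost_disjoint (fst ` W)"
  unfolding almost_disjoint_def coherent_def inf_subsets_def by fastforce

definition fresh :: "(nat set \<times> node set) set \<Rightarrow> node \<Rightarrow> bool" where
  "fresh W \<tau> \<longleftrightarrow> is_node \<tau> \<and> (\<forall>\<nu>\<in>\<Union>(snd ` W). \<not> \<tau> \<subseteq>\<^sub>m \<nu>)"

definition comparable :: "(nat set \<times> node set) set \<Rightarrow> node \<Rightarrow> nat set set" where
  "comparable W \<tau> = fst ` {p \<in> W. \<exists>\<nu>\<in>snd p. \<nu> \<subseteq>\<^sub>m \<tau>}"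

lemma comparable_less_b:
  assumes W: "coherent W"
  shows "|comparable W \<tau>| <o \<bb>"
proof -
  define h where "h \<nu> = fst (SOME p. p \<in> W \<and> \<nu> \<in> snd p)" for \<nu>
  have "comparable W \<tau> \<subseteq> h ` {\<nu>. is_node \<nu> \<and> \<nu> \<subseteq>\<^sub>m \<tau>}"
  proof
    fix a assume "a \<in> comparable W \<tau>"
    then obtain p \<nu> where p: "p \<in> W" "\<nu> \<in> snd p" "\<nu> \<subseteq>\<^sub>m \<tau>" "a = fst p"
      by (auto simp: comparable_def)
    have "(SOME p. p \<in> W \<and> \<nu> \<in> snd p) = p"
    proof (rule some_equality)
      fix q assume "q \<in> W \<and> \<nu> \<in> snd q"
      then show "q = p"
        using W p(1,2) unfolding coherent_def by blast
    qed (use p in simp)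
    then have "a = h \<nu>"
      using p(4) by (simp add: h_def)
    moreover have "is_node \<nu>"
      using W p(1,2) unfolding coherent_def by blast
    ultimately show "a \<in> h ` {\<nu>. is_node \<nu> \<and> \<nu> \<subseteq>\<^sub>m \<tau>}"
      using p(3) by blast
  qed
  then show ?thesis
    by (rule subset_less_bounding_number[OF _ image_less_bounding_number[OF initial_nodes_less_b]])
qed

text \<open>Every node of \<open>a\<close> contradicts \<open>\<tau>\<close> somewhere: freshness
  excludes one inclusion, incomparability the other. There \<open>x \<inter> a\<close> almost misses
  the side chosen by that node, so \<open>carried_by\<close> applies.\<close>

lemma orthogonal_to_incomparable:
  assumes W: "coherent W" and \<tau>: "fresh W \<tau>" and a: "a \<in> fst ` W" "a \<notin> comparable W \<tau>"
    and fin: "\<And>\<xi> i. \<tau> \<xi> = Some i \<Longrightarrow> finite (x \<inter> a \<inter> side (\<not> i) \<xi>)"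
  shows "finite (x \<inter> a)"
proof -
  obtain p where p: "p \<in> W" "a = fst p"
    using a(1) by blast
  have incomp: "\<not> \<nu> \<subseteq>\<^sub>m \<tau>" if "\<nu> \<in> snd p" for \<nu>
    using a(2) p that by (auto simp: comparable_def)
  have carried: "carried_by a (snd p)" and nodes: "\<And>\<nu>. \<nu> \<in> snd p \<Longrightarrow> is_node \<nu>"
    using W p unfolding coherent_def by blast+
  have "\<exists>\<xi> i. \<nu> \<xi> = Some i \<and> finite (x \<inter> a \<inter> side i \<xi>)" if \<nu>: "\<nu> \<in> snd p" for \<nu>
  proof -
    have "\<not> \<tau> \<subseteq>\<^sub>m \<nu>" "is_node \<tau>"
      using \<tau> \<nu> p(1) by (auto simp: fresh_def)
    then obtain \<xi> i where "\<nu> \<xi> = Some i" "\<tau> \<xi> = Some (\<not> i)"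
      using incompatible_nodes[OF nodes[OF \<nu>]] incomp[OF \<nu>] by blast
    then show ?thesis
      using fin[of \<xi> "\<not> i"] by auto
  qed
  then show ?thesis
    using carried unfolding carried_by_def by (meson inf_le2)
qed

section \<open>Fresh nodes for positive sets and for sequences\<close>

lemma fresh_positive_branch:
  assumes W: "coherent W" and small: "|\<Union>(snd ` W)| <o |UNIV :: nat set set|"
    and b: "b \<in> positive_sets (fst ` W)"
  shows "\<exists>x \<nu>. x \<subseteq> b \<and> infinite x \<and> (\<forall>a\<in>fst ` W. finite (x \<inter> a)) \<and> fresh W \<nu> \<and>
    (\<forall>\<xi> i. \<nu> \<xi> = Some i \<longrightarrow> finite (x \<inter> side (\<not> i) \<xi>))"
proof -
  let ?A = "fst ` W"
  have A: "almost_disjoint ?A"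
    using W by (rule coherent_almost_disjoint)
  have "\<exists>\<tau> C. C \<subseteq> b \<and> C \<in> positive_sets ?A \<and> is_node \<tau> \<and> (\<forall>\<nu>\<in>\<Union>(snd ` W). \<not> \<tau> \<subseteq>\<^sub>m \<nu>) \<and>
    (\<forall>\<xi> i. \<tau> \<xi> = Some i \<longrightarrow> \<not> C \<inter> side (\<not> i) \<xi> \<in> positive_sets ?A)"
  proof (rule fresh_branch[where P = "\<lambda>x. x \<in> positive_sets ?A" and E = "\<lambda>\<xi>. \<xi>", OF WELL _ _ _ _ _ b small])
    show "{} \<notin> positive_sets ?A"
      using positive_sets_infinite by blast
    show "\<exists>\<xi>\<in>Field |S|. X \<inter> \<xi> \<in> positive_sets ?A \<and> X \<inter> - \<xi> \<in> positive_sets ?A"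
      if "X \<in> positive_sets ?A" for X
      using positive_split[OF omega_omega_splitting A that] by (simp add: Field_card_of)
    show "\<exists>X. X \<in> positive_sets ?A \<and> (\<forall>n. X - C n \<notin> positive_sets ?A)"
      if "\<And>n. C n \<in> positive_sets ?A" "antimono C" for C :: "nat \<Rightarrow> nat set"
      using positive_pseudo_intersection[OF A that] positive_sets_infinite by blast
  qed (fact positive_sets_mono positive_sets_Un)+
  then obtain \<tau> C where C: "C \<subseteq> b" "C \<in> positive_sets ?A" and \<tau>: "fresh W \<tau>"
    and neg: "\<And>\<xi> i. \<tau> \<xi> = Some i \<Longrightarrow> C \<inter> side (\<not> i) \<xi> \<notin> positive_sets ?A"
    unfolding fresh_def by blast
  \<comment> \<open>The parts of \<open>C\<close> off the node are only known to lie in the ideal.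
    Together with the comparable members they are fewer than \<open>\<bb>\<close>, so
    \<open>C\<close> can be thinned to meet all of them finitely.\<close>
  let ?G = "(\<lambda>\<xi>. C \<inter> side (\<not> the (\<tau> \<xi>)) \<xi>) ` dom \<tau>"
  have "dom \<tau> \<subseteq> S"
    using \<tau> by (intro dom_node) (simp add: fresh_def)
  then have "|?G| <o \<bb>"
    by (intro image_less_bounding_number subset_less_bounding_number[OF _ less_b])
  then have "|?G \<union> comparable W \<tau>| <o \<bb>"
    using comparable_less_b[OF W] by (rule Un_less_bounding_number)
  moreover have "?G \<union> comparable W \<tau> \<subseteq> generated_ideal ?A"
  proof -
    have "?G \<subseteq> generated_ideal ?A"
      using neg by (auto simp: positive_sets_def)
    moreover have "?A \<subseteq> generated_ideal ?A"
      by (auto simp: generated_ideal_def)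
    ultimately show ?thesis
      by (auto simp: comparable_def)
  qed
  ultimately have "\<exists>x\<subseteq>C. infinite x \<and> (\<forall>G\<in>?G \<union> comparable W \<tau>. finite (x \<inter> G))"
    by (intro positive_diagonal[OF A C(2)])
  then obtain x where x: "x \<subseteq> C" "infinite x" "\<forall>G\<in>?G \<union> comparable W \<tau>. finite (x \<inter> G)"
    by meson
  have x_side: "finite (x \<inter> side (\<not> i) \<xi>)" if "\<tau> \<xi> = Some i" for \<xi> i
  proof -
    have "C \<inter> side (\<not> i) \<xi> \<in> ?G"
      using that by (auto intro!: rev_image_eqI[of \<xi>])
    then have "finite (x \<inter> (C \<inter> side (\<not> i) \<xi>))"
      using x(3) by blast
    moreover have "x \<inter> (C \<inter> side (\<not> i) \<xi>) = x \<inter> side (\<not> i) \<xi>"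
      using x(1) by blast
    ultimately show ?thesis
      by simp
  qed
  have "finite (x \<inter> a)" if a: "a \<in> ?A" for a
  proof (cases "a \<in> comparable W \<tau>")
    case True
    then show ?thesis
      using x(3) by blast
  next
    case False
    show ?thesis
    proof (rule orthogonal_to_incomparable[OF W \<tau> a False])
      fix \<xi> i assume "\<tau> \<xi> = Some i"
      then have "finite (x \<inter> side (\<not> i) \<xi>)"
        by (rule x_side)
      then show "finite (x \<inter> a \<inter> side (\<not> i) \<xi>)"
        by (rule finite_subset[rotated]) blast
    qed
  qed
  then show ?thesis
    using x(1,2) C(1) \<tau> x_side by (intro exI[of _ x] exI[of _ \<tau>]) auto
qed

lemma fresh_sequence_branch:
  fixes x :: "nat \<Rightarrow> nat set"
  assumes small: "|\<Union>(snd ` W)| <o |UNIV :: nat set set|" and x: "\<And>n. infinite (x n)"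
  shows "\<exists>c \<tau>. (\<forall>n. c n \<subseteq> x n) \<and> (\<exists>\<^sub>\<infinity>n. infinite (c n)) \<and> fresh W \<tau> \<and>
    (\<forall>\<xi> i. \<tau> \<xi> = Some i \<longrightarrow> (\<forall>\<^sub>\<infinity>n. finite (c n \<inter> side (\<not> i) \<xi>)))"
proof -
  \<comment> \<open>Coding the sequence as a subset of the plane keeps overlapping \<open>x n\<close> apart, so that the
    coideal of sets with infinitely many infinite sections has pseudo-intersections.\<close>
  define E :: "nat set \<Rightarrow> (nat \<times> nat) set" where "E \<xi> = UNIV \<times> \<xi>" for \<xi>
  have E: "(X \<inter> E \<xi>) `` {n} = X `` {n} \<inter> \<xi>" "(X \<inter> - E \<xi>) `` {n} = X `` {n} \<inter> - \<xi>" for X n \<xi>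
    by (auto simp: E_def)
  define P where "P X \<longleftrightarrow> (\<exists>\<^sub>\<infinity>n. infinite (X `` {n}))" for X :: "(nat \<times> nat) set"
  have "\<exists>\<tau> C. C \<subseteq> Sigma UNIV x \<and> P C \<and> is_node \<tau> \<and> (\<forall>\<nu>\<in>\<Union>(snd ` W). \<not> \<tau> \<subseteq>\<^sub>m \<nu>) \<and>
    (\<forall>\<xi> i. \<tau> \<xi> = Some i \<longrightarrow> \<not> P (C \<inter> side (\<not> i) (E \<xi>)))"
  proof (rule fresh_branch[OF WELL _ _ _ _ _ _ small])
    show "P Y" if "P X" "X \<subseteq> Y" for X Y
      using that(1) unfolding P_def by (rule INFM_mono) (meson Image_mono finite_subset order_refl that(2))
    show "P X \<or> P Y" if "P (X \<union> Y)" for X Y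
      using that unfolding P_def Un_Image by (rule frequently_infinite_Un)
    show "\<not> P {}"
      by (simp add: P_def)
    show "P (Sigma UNIV x)"
    proof -
      have "Sigma UNIV x `` {n} = x n" for n
        by auto
      then show ?thesis
        using x by (simp add: P_def)
    qed
    show "\<exists>\<xi>\<in>Field |S|. P (X \<inter> E \<xi>) \<and> P (X \<inter> - E \<xi>)" if "P X" for X
    proof -
      obtain \<xi> where \<xi>: "\<xi> \<in> S"
        "\<exists>\<^sub>\<infinity>n. infinite (X `` {n} \<inter> \<xi>)" "\<exists>\<^sub>\<infinity>n. infinite (X `` {n} \<inter> - \<xi>)"
        using omega_omega_splitting_frequently[OF omega_omega_splitting \<open>P X\<close>[unfolded P_def]] by blast
      have "P (X \<inter> E \<xi>)" "P (X \<inter> - E \<xi>)"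
        unfolding P_def E by (fact \<xi>)+
      then show ?thesis
        using \<xi>(1) by (auto simp: Field_card_of)
    qed
    show "\<exists>X. P X \<and> (\<forall>n. \<not> P (X - C n))" if PC: "\<And>n. P (C n)" and C: "antimono C" for C :: "nat \<Rightarrow> (nat \<times> nat) set"
    proof -
      have ex: "\<exists>n>m. infinite (C k `` {n})" for k m
        using PC[of k] unfolding P_def INFM_nat by blast
      \<comment> \<open>One infinite column of each \<open>C k\<close> is kept, with increasing
        indices; points of \<open>X\<close> outside \<open>C n\<close> then lie in the first
        \<open>n\<close> chosen columns.\<close>
      have "\<exists>u. \<forall>k. infinite (C k `` {u k}) \<and> u k < u (Suc k)"
        by (rule dependent_nat_choice) (use ex in blast)+
      then obtain u where u: "\<And>k. infinite (C k `` {u k})" "\<And>k. u k < u (Suc k)"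
        by blast
      then have inj: "inj u"
        by (intro strict_mono_imp_inj_on) (simp add: strict_mono_Suc_iff)
      define X where "X = (\<Union>k. {u k} \<times> C k `` {u k})"
      have X: "X `` {u k} = C k `` {u k}" for k
        using inj by (auto simp: X_def dest: injD)
      have "P X"
        unfolding P_def by (rule INFM_inj[OF _ inj]) (simp add: X u)
      moreover have "\<not> P (X - C n)" for n
      proof -
        have "{m. infinite ((X - C n) `` {m})} \<subseteq> u ` {..<n}"
        proof
          fix m assume "m \<in> {m. infinite ((X - C n) `` {m})}"
          then obtain z where z: "(m, z) \<in> X" "(m, z) \<notin> C n"
            by (auto dest!: infinite_imp_nonempty)
          then obtain k where k: "m = u k" "(m, z) \<in> C k"
            by (auto simp: X_def)
          then have "\<not> n \<le> k"
            using z(2) antimonoD[OF C, of n k] by blast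
          then show "m \<in> u ` {..<n}"
            using k(1) by simp
        qed
        then show ?thesis
          unfolding P_def INFM_iff_infinite using finite_subset by blast
      qed
      ultimately show ?thesis
        by blast
    qed
  qed
  then obtain \<tau> C where C: "C \<subseteq> Sigma UNIV x" "P C" and \<tau>: "fresh W \<tau>"
    and neg: "\<And>\<xi> i. \<tau> \<xi> = Some i \<Longrightarrow> \<not> P (C \<inter> side (\<not> i) (E \<xi>))"
    unfolding fresh_def by blast
  have "\<forall>\<^sub>\<infinity>n. finite (C `` {n} \<inter> side (\<not> i) \<xi>)" if "\<tau> \<xi> = Some i" for \<xi> i
    using neg[OF that] unfolding P_def by (cases i) (simp_all add: E)
  moreover have "C `` {n} \<subseteq> x n" for n
    using C(1) by auto
  moreover have "\<exists>\<^sub>\<infinity>n. infinite (C `` {n})"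
    using C(2) by (simp add: P_def)
  ultimately show ?thesis
    using \<tau> by (intro exI[of _ "\<lambda>n. C `` {n}"] exI[of _ \<tau>]) blast
qed

end

section \<open>The recursion\<close>

lemma maximum_exists:
  assumes "Well_order r" "finite D" "D \<noteq> {}" "D \<subseteq> Field r"
  shows "\<exists>m\<in>D. \<forall>x\<in>D. (x, m) \<in> r"
  using assms(2-4)
proof (induction D rule: finite_ne_induct)
  case (singleton x)
  interpret wo_rel r using assms(1) by (simp add: wo_rel_def)
  show ?case
    using singleton TOTALS by auto
next
  case (insert x D)
  interpret wo_rel r using assms(1) by (simp add: wo_rel_def)
  obtain m where m: "m \<in> D" "\<forall>x\<in>D. (x, m) \<in> r"
    using insert by auto
  have rx: "(x, x) \<in> r"
    using insert.prems TOTALS by auto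
  show ?case
  proof (cases "(x, m) \<in> r")
    case True
    then show ?thesis
      using m by auto
  next
    case False
    then have "(m, x) \<in> r"
      using TOTALS insert.prems m(1) by auto
    then have "\<forall>y\<in>D. (y, x) \<in> r"
      using m(2) TRANS by (meson transD)
    then show ?thesis
      using rx by auto
  qed
qed

lemma continuum_eq_card_nat_sets: "|UNIV :: nat set set| =o continuum"
proof -
  have "|Pow (UNIV :: nat set)| =o |Func (UNIV :: nat set) (UNIV :: bool set)|"
    by (rule card_of_Pow_Func)
  then show ?thesis
    by (simp add: continuum_def cexp_def ctwo_def Field_card_of Field_natLeq)
qed

lemma card_of_sequences_le: "|UNIV :: (nat \<Rightarrow> nat set) set| \<le>o |UNIV :: nat set set|"
proof -
  have "inj (\<lambda>f. prod_encode ` Sigma UNIV f :: nat set)"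
  proof (rule injI)
    fix f g :: "nat \<Rightarrow> nat set"
    assume "prod_encode ` Sigma UNIV f = prod_encode ` Sigma UNIV g"
    then have "Sigma UNIV f = Sigma UNIV g"
      by (simp add: inj_image_eq_iff[OF inj_prod_encode])
    then show "f = g"
      by (auto simp: set_eq_iff)
  qed
  then show ?thesis
    using card_of_ordLeq by blast
qed

context small_splitting
begin

text \<open>
  The condition on \<open>UNIV\<close> keeps the recursion from stopping at a finite family that covers
  \<open>\<omega>\<close> up to a finite set; it is what makes the family have size \<open>\<cc>\<close>.
\<close>

definition extension :: "(nat set \<times> node set) set \<Rightarrow> (nat \<Rightarrow> nat set) \<Rightarrow> nat set \<times> node set \<Rightarrow> bool" where
  "extension W b p \<longleftrightarrow>
    infinite (fst p) \<and> carried_by (fst p) (snd p) \<and> |snd p| \<le>o |UNIV :: nat set| \<and> (\<forall>\<nu>\<in>snd p. is_node \<nu>) \<and>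
    (\<forall>q\<in>W. finite (fst p \<inter> fst q) \<and> snd p \<inter> snd q = {}) \<and>
    UNIV \<in> positive_sets (insert (fst p) (fst ` W)) \<and> (\<exists>\<^sub>\<infinity>n. infinite (b n \<inter> fst p))"

lemma extension_exists:
  assumes W: "coherent W" and small: "|\<Union>(snd ` W)| <o |UNIV :: nat set set|"
    and b: "\<And>n. b n \<in> positive_sets (fst ` W)"
  shows "\<exists>p. extension W b p"
proof -
  let ?A = "fst ` W"
  have "\<forall>n. \<exists>x \<nu>. x \<subseteq> b n \<and> infinite x \<and> (\<forall>a\<in>?A. finite (x \<inter> a)) \<and> fresh W \<nu> \<and>
    (\<forall>\<xi> i. \<nu> \<xi> = Some i \<longrightarrow> finite (x \<inter> side (\<not> i) \<xi>))"
    using fresh_positive_branch[OF W small b] by blast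
  then obtain x \<nu> where x: "\<And>n. x n \<subseteq> b n" "\<And>n. infinite (x n)" "\<And>n a. a \<in> ?A \<Longrightarrow> finite (x n \<inter> a)"
    and \<nu>: "\<And>n. fresh W (\<nu> n)" "\<And>n \<xi> i. \<nu> n \<xi> = Some i \<Longrightarrow> finite (x n \<inter> side (\<not> i) \<xi>)"
    by metis
  obtain d \<tau> where d: "\<forall>n. d n \<subseteq> x n" "\<exists>\<^sub>\<infinity>n. infinite (d n)" and \<tau>: "fresh W \<tau>"
    and d\<tau>: "\<forall>\<xi> i. \<tau> \<xi> = Some i \<longrightarrow> (\<forall>\<^sub>\<infinity>n. finite (d n \<inter> side (\<not> i) \<xi>))"
    using fresh_sequence_branch[of W x, OF small x(2)] by (elim exE conjE)
  obtain e where e: "\<exists>\<^sub>\<infinity>n. infinite (d n \<inter> e)" "\<exists>\<^sub>\<infinity>n. infinite (d n \<inter> - e)"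
    using omega_omega_splitting_frequently[OF omega_omega_splitting d(2)] by blast
  \<comment> \<open>Only the half inside \<open>e\<close> is used; the other half witnesses that \<open>UNIV\<close> stays positive.\<close>
  define c where "c n = d n \<inter> e" for n
  have c_x: "c n \<subseteq> x n" for n
    using d(1) by (auto simp: c_def)
  have c_A: "finite (c n \<inter> a)" if "a \<in> ?A" for n a
    by (rule finite_subset[OF _ x(3)[OF that, of n]]) (use c_x in blast)
  have c_\<nu>: "finite (c n \<inter> side (\<not> i) \<xi>)" if "\<nu> n \<xi> = Some i" for n \<xi> i
    by (rule finite_subset[OF _ \<nu>(2)[OF that]]) (use c_x in blast)
  \<comment> \<open>The sets left to domination: the sides opposite to \<open>\<tau>\<close> and the
    earlier members with a node below \<open>\<tau>\<close>.\<close>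
  define \<G> where "\<G> = (\<lambda>\<xi>. side (\<not> the (\<tau> \<xi>)) \<xi>) ` dom \<tau> \<union> comparable W \<tau>"
  have "dom \<tau> \<subseteq> S"
    using \<tau> by (intro dom_node) (simp add: fresh_def)
  then have "|\<G>| <o \<bb>"
    unfolding \<G>_def using comparable_less_b[OF W]
    by (intro Un_less_bounding_number image_less_bounding_number) (rule subset_less_bounding_number[OF _ less_b])
  moreover have "\<forall>G\<in>\<G>. \<forall>\<^sub>\<infinity>n. finite (G \<inter> c n)"
  proof
    fix G assume "G \<in> \<G>"
    then consider \<xi> i where "\<tau> \<xi> = Some i" "G = side (\<not> i) \<xi>" | "G \<in> ?A"
      unfolding \<G>_def comparable_def by (auto simp: dom_def)
    then show "\<forall>\<^sub>\<infinity>n. finite (G \<inter> c n)"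
    proof cases
      case 1
      show ?thesis
        using d\<tau>[rule_format, OF 1(1)]
      proof (rule MOST_mono)
        fix n assume "finite (d n \<inter> side (\<not> i) \<xi>)"
        then show "finite (G \<inter> c n)"
          by (rule finite_subset[rotated]) (auto simp: c_def 1(2))
      qed
    next
      case 2
      then show ?thesis
        using c_A by (simp add: Int_commute)
    qed
  qed
  ultimately obtain g :: "nat \<Rightarrow> nat" where g: "\<forall>G\<in>\<G>. \<forall>\<^sub>\<infinity>n. G \<inter> c n \<subseteq> {..<g n}"
    using almost_disjoint_bound by blast
  \<comment> \<open>Removing the part of \<open>c n\<close> below \<open>g n\<close> confines
    \<open>a \<inter> G\<close>, for \<open>G \<in> \<G>\<close>, to finitely many
    \<open>c n\<close>.\<close>
  define a where "a = (\<Union>n. c n - {..<g n})"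
  have a_\<G>: "\<exists>m. a \<inter> G \<subseteq> (\<Union>n<m. c n)" if "G \<in> \<G>" for G
  proof -
    obtain m where m: "\<forall>n\<ge>m. G \<inter> c n \<subseteq> {..<g n}"
      using g \<open>G \<in> \<G>\<close> unfolding MOST_nat_le by blast
    have "a \<inter> G \<subseteq> (\<Union>n<m. c n)"
    proof
      fix z assume "z \<in> a \<inter> G"
      then obtain n where n: "z \<in> c n" "z \<notin> {..<g n}" "z \<in> G"
        by (auto simp: a_def)
      then have "\<not> m \<le> n"
        using m by blast
      then show "z \<in> (\<Union>n<m. c n)"
        using n(1) by auto
    qed
    then show ?thesis
      by blast
  qed
  have a_side: "\<exists>m. a \<inter> side (\<not> i) \<xi> \<subseteq> (\<Union>n<m. c n)" if "\<tau> \<xi> = Some i" for \<xi> i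
    using that by (intro a_\<G>) (auto simp: \<G>_def intro!: rev_image_eqI[of \<xi>])
  have a_c: "c n - {..<g n} \<subseteq> a" for n
    by (auto simp: a_def)
  define N where "N = insert \<tau> (range \<nu>)"
  have N_fresh: "fresh W \<mu>" if "\<mu> \<in> N" for \<mu>
    using that \<tau> \<nu>(1) by (auto simp: N_def)
  \<comment> \<open>Up to a finite set, \<open>\<tau>\<close> confines \<open>y\<close> to finitely
    many \<open>c n\<close>, and \<open>\<nu> n\<close> makes each \<open>y \<inter> c n\<close>
    finite.\<close>
  have carried: "carried_by a N"
    unfolding carried_by_def
  proof (intro allI impI)
    fix y assume y: "y \<subseteq> a" "\<forall>\<mu>\<in>N. \<exists>\<xi> i. \<mu> \<xi> = Some i \<and> finite (y \<inter> side i \<xi>)"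
    obtain \<xi> i where \<xi>: "\<tau> \<xi> = Some i" "finite (y \<inter> side i \<xi>)"
      using y(2) unfolding N_def by blast
    obtain m where m: "a \<inter> side (\<not> i) \<xi> \<subseteq> (\<Union>n<m. c n)"
      using a_side[OF \<xi>(1)] by blast
    have fin: "finite (y \<inter> c n)" for n
    proof -
      obtain \<zeta> j where \<zeta>: "\<nu> n \<zeta> = Some j" "finite (y \<inter> side j \<zeta>)"
        using y(2) unfolding N_def by blast
      have "finite ((y \<inter> side j \<zeta>) \<union> (c n \<inter> side (\<not> j) \<zeta>))"
        using \<zeta>(2) c_\<nu>[OF \<zeta>(1)] by simp
      moreover have "y \<inter> c n \<subseteq> (y \<inter> side j \<zeta>) \<union> (c n \<inter> side (\<not> j) \<zeta>)"
        using Int_side_Un[of "y \<inter> c n" j \<zeta>] by blast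
      ultimately show ?thesis
        by (rule finite_subset[rotated])
    qed
    have "y \<subseteq> (y \<inter> side i \<xi>) \<union> (\<Union>n<m. y \<inter> c n)"
      using Int_side_Un[of y i \<xi>] y(1) m by blast
    moreover have "finite ((y \<inter> side i \<xi>) \<union> (\<Union>n<m. y \<inter> c n))"
      using \<xi>(2) fin by (intro finite_UnI finite_UN_I) auto
    ultimately show "finite y"
      by (rule finite_subset)
  qed
  have disjoint: "finite (a \<inter> a')" if a': "a' \<in> ?A" for a'
  proof -
    have fin: "finite (a' \<inter> (\<Union>n<m. c n))" for m
    proof (rule finite_subset)
      show "a' \<inter> (\<Union>n<m. c n) \<subseteq> (\<Union>n<m. c n \<inter> a')"
        by blast
      show "finite (\<Union>n<m. c n \<inter> a')"
        by (intro finite_UN_I c_A[OF a']) simp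
    qed
    show ?thesis
    proof (cases "a' \<in> comparable W \<tau>")
      case True
      then have "a' \<in> \<G>"
        by (simp add: \<G>_def)
      then obtain m where "a \<inter> a' \<subseteq> (\<Union>n<m. c n)"
        using a_\<G> by blast
      then have "a \<inter> a' \<subseteq> a' \<inter> (\<Union>n<m. c n)"
        by blast
      then show ?thesis
        using fin by (rule finite_subset)
    next
      case False
      \<comment> \<open>Opposite to a side of \<open>\<tau>\<close>, \<open>a\<close> lies in
        finitely many \<open>c n\<close>, each almost disjoint from \<open>a'\<close>.\<close>
      show ?thesis
      proof (rule orthogonal_to_incomparable[OF W \<tau> a' False])
        fix \<xi> i assume "\<tau> \<xi> = Some i"
        then obtain m where "a \<inter> side (\<not> i) \<xi> \<subseteq> (\<Union>n<m. c n)"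
          using a_side by blast
        then have "a \<inter> a' \<inter> side (\<not> i) \<xi> \<subseteq> a' \<inter> (\<Union>n<m. c n)"
          by blast
        then show "finite (a \<inter> a' \<inter> side (\<not> i) \<xi>)"
          using fin by (rule finite_subset)
      qed
    qed
  qed
  have meets: "\<exists>\<^sub>\<infinity>n. infinite (b n \<inter> a)"
    using e(1)
  proof (rule INFM_mono)
    fix n assume "infinite (d n \<inter> e)"
    then have "infinite (c n - {..<g n})"
      by (simp add: c_def)
    moreover have "c n - {..<g n} \<subseteq> b n \<inter> a"
      using a_c c_x x(1) by blast
    ultimately show "infinite (b n \<inter> a)"
      using finite_subset by blast
  qed
  then have inf_a: "infinite a"
    by (metis INFM_EX finite_Int)
  have positive: "UNIV \<in> positive_sets (insert a ?A)"
  proof -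
    obtain n where "infinite (d n \<inter> - e)"
      using INFM_EX[OF e(2)] by blast
    moreover have "d n \<inter> - e \<inter> a = {}"
      by (auto simp: a_def c_def)
    moreover have "finite (d n \<inter> - e \<inter> a')" if "a' \<in> ?A" for a'
      by (rule finite_subset[OF _ x(3)[OF that, of n]]) (use d(1) in blast)
    ultimately have "d n \<inter> - e \<in> positive_sets (insert a ?A)"
      by (intro positive_if_orthogonal) auto
    then show ?thesis
      by (rule positive_sets_mono) simp
  qed
  have "N = range (case_nat \<tau> \<nu>)"
    by (auto simp: N_def image_iff split: nat.splits)
  then have card_N: "|N| \<le>o |UNIV :: nat set|"
    using card_of_image by metis
  have "snd q \<inter> N = {}" if "q \<in> W" for q
    using N_fresh that unfolding fresh_def by (auto simp: map_le_def)
  then have "extension W b (a, N)"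
    unfolding extension_def using inf_a carried card_N N_fresh disjoint positive meets
    by (auto simp: fresh_def)
  then show ?thesis
    by blast
qed

section \<open>Transfinite recursion over all sequences of sets\<close>

definition stage_order :: "(nat \<Rightarrow> nat set) rel" where
  "stage_order = |UNIV| - Id"

lemma wf_stage_order: "wf stage_order"
  using card_of_well_order_on[of "UNIV :: (nat \<Rightarrow> nat set) set"]
  by (simp add: stage_order_def well_order_on_def)

lemma stage_order_total: "\<gamma> \<noteq> \<delta> \<Longrightarrow> (\<gamma>, \<delta>) \<in> stage_order \<or> (\<delta>, \<gamma>) \<in> stage_order"
  using card_of_well_order_on[of "UNIV :: (nat \<Rightarrow> nat set) set"]
  by (auto simp: stage_order_def order_on_defs total_on_def)

text \<open>A stage is itself the sequence to be treated; \<open>None\<close> skips a sequence with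
  a term not positive for the family built so far.\<close>

definition choose_next ::
    "((nat \<Rightarrow> nat set) \<Rightarrow> (nat set \<times> node set) option) \<Rightarrow> (nat \<Rightarrow> nat set) \<Rightarrow> (nat set \<times> node set) option" where
  "choose_next f \<delta> =
    (let W = {p. \<exists>\<gamma>. (\<gamma>, \<delta>) \<in> stage_order \<and> f \<gamma> = Some p} in
     if \<forall>n. \<delta> n \<in> positive_sets (fst ` W) then Some (SOME p. extension W \<delta> p) else None)"

definition member :: "(nat \<Rightarrow> nat set) \<Rightarrow> (nat set \<times> node set) option" where
  "member = wfrec stage_order choose_next"

definition before :: "(nat \<Rightarrow> nat set) \<Rightarrow> (nat set \<times> node set) set" where
  "before \<delta> = {p. \<exists>\<gamma>. (\<gamma>, \<delta>) \<in> stage_order \<and> member \<gamma> = Some p}"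

lemma member_unfold:
  "member \<delta> = (if \<forall>n. \<delta> n \<in> positive_sets (fst ` before \<delta>)
    then Some (SOME p. extension (before \<delta>) \<delta> p) else None)"
proof -
  have "{p. \<exists>\<gamma>. (\<gamma>, \<delta>) \<in> stage_order \<and> cut member stage_order \<delta> \<gamma> = Some p} = before \<delta>"
    unfolding before_def by (auto simp: cut_apply)
  moreover have "member \<delta> = choose_next (cut member stage_order \<delta>) \<delta>"
    unfolding member_def by (rule wfrec[OF wf_stage_order])
  ultimately show ?thesis
    by (simp add: choose_next_def Let_def)
qed

lemma card_nodes_before: 
  assumes "coherent (before \<delta>)"
  shows "|\<Union>(snd ` before \<delta>)| <o |UNIV :: nat set set|"
proof -
  let ?r = "|UNIV :: (nat \<Rightarrow> nat set) set|"
  have "|Order_Relation.underS ?r \<delta>| <o ?r"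
    by (rule card_of_underS) (simp_all add: Field_card_of card_of_card_order_on)
  moreover have "before \<delta> \<subseteq> (\<lambda>\<gamma>. the (member \<gamma>)) ` Order_Relation.underS ?r \<delta>"
    by (force simp: before_def stage_order_def Order_Relation.underS_def)
  then have "|before \<delta>| \<le>o |Order_Relation.underS ?r \<delta>|"
    using surj_imp_ordLeq by blast
  ultimately have before: "|before \<delta>| <o |UNIV :: nat set set|"
    using card_of_sequences_le ordLeq_ordLess_trans ordLess_ordLeq_trans by blast
  have uncountable: "|UNIV :: nat set| <o |UNIV :: nat set set|"
    using card_of_Pow[of "UNIV :: nat set"] by simp
  \<comment> \<open>The summand \<omega> bounds the countable node sets and keeps the bound infinite
    at early stages.\<close>
  let ?B = "before \<delta> <+> (UNIV :: nat set)"
  have "|?B| <o |UNIV :: nat set set|"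
    by (rule card_of_Plus_ordLess_infinite[OF _ before uncountable]) (simp add: Finite_Set.finite_set)
  moreover have "|\<Union>p\<in>before \<delta>. snd p| \<le>o |?B|"
  proof (rule card_of_UNION_ordLeq_infinite)
    show "infinite ?B"
      by simp
    show "|before \<delta>| \<le>o |?B|"
      by (rule card_of_Plus1)
    show "\<forall>p\<in>before \<delta>. |snd p| \<le>o |?B|"
      using assms card_of_Plus2[of "UNIV :: nat set" "before \<delta>"] ordLeq_transitive
      unfolding coherent_def by blast
  qed
  ultimately show ?thesis
    using ordLeq_ordLess_trans by blast
qed

lemma extension_member:
  assumes "coherent (before \<delta>)" "member \<delta> = Some p"
  shows "extension (before \<delta>) \<delta> p"
proof -
  have *: "\<forall>n. \<delta> n \<in> positive_sets (fst ` before \<delta>)"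
    using assms(2) by (subst (asm) member_unfold) (simp split: if_splits)
  then have "p = (SOME p. extension (before \<delta>) \<delta> p)"
    using assms(2) by (subst (asm) member_unfold) simp
  moreover have "\<exists>p. extension (before \<delta>) \<delta> p"
    using * by (intro extension_exists assms(1) card_nodes_before) blast
  ultimately show ?thesis
    by (metis someI_ex)
qed

text \<open>Of two stages the later was chosen against the earlier. A general \<open>D\<close>
  serves both the initial segments in the induction and the whole family.\<close>

lemma coherent_if_extensions:
  assumes "\<And>\<gamma> p. \<gamma> \<in> D \<Longrightarrow> member \<gamma> = Some p \<Longrightarrow> extension (before \<gamma>) \<gamma> p"
  shows "coherent {p. \<exists>\<gamma>\<in>D. member \<gamma> = Some p}"
proof -
  have later: "finite (fst p \<inter> fst q) \<and> snd p \<inter> snd q = {}"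
    if "\<gamma> \<in> D" "member \<gamma> = Some p" "member \<delta> = Some q" "(\<delta>, \<gamma>) \<in> stage_order" for \<gamma> \<delta> p q
  proof -
    have "q \<in> before \<gamma>"
      using that by (auto simp: before_def)
    then show ?thesis
      using assms[OF that(1,2)] by (auto simp: extension_def)
  qed
  have "finite (fst p \<inter> fst q) \<and> snd p \<inter> snd q = {}"
    if pq: "\<gamma> \<in> D" "member \<gamma> = Some p" "\<delta> \<in> D" "member \<delta> = Some q" "p \<noteq> q" for \<gamma> \<delta> p q
  proof -
    have "\<gamma> \<noteq> \<delta>"
      using pq by auto
    then consider "(\<delta>, \<gamma>) \<in> stage_order" | "(\<gamma>, \<delta>) \<in> stage_order"
      using stage_order_total by blast
    then show ?thesis
    proof cases
      case 1
      then show ?thesis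
        by (rule later[OF pq(1,2,4)])
    next
      case 2
      then show ?thesis
        using later[OF pq(3,4,2)] by (simp add: Int_commute)
    qed
  qed
  moreover have "infinite (fst p) \<and> carried_by (fst p) (snd p) \<and> |snd p| \<le>o |UNIV :: nat set| \<and>
      (\<forall>\<nu>\<in>snd p. is_node \<nu>)"
    if "\<gamma> \<in> D" "member \<gamma> = Some p" for \<gamma> p
    using assms[OF that] by (simp add: extension_def)
  ultimately show ?thesis
    unfolding coherent_def by blast
qed

lemma coherent_before: "coherent (before \<delta>)"
proof (induction \<delta> rule: wf_induct_rule[OF wf_stage_order])
  case (1 \<delta>)
  have "coherent {p. \<exists>\<gamma>\<in>{\<gamma>. (\<gamma>, \<delta>) \<in> stage_order}. member \<gamma> = Some p}"
    by (rule coherent_if_extensions) (use 1 extension_member in blast)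
  then show ?case
    by (simp add: before_def)
qed

section \<open>Weak tightness and size of the resulting family\<close>

definition members :: "(nat set \<times> node set) set" where
  "members = {p. \<exists>\<gamma>. member \<gamma> = Some p}"

lemma member_extension: "member \<gamma> = Some p \<Longrightarrow> extension (before \<gamma>) \<gamma> p"
  using coherent_before by (rule extension_member)

lemma coherent_members: "coherent members"
  using coherent_if_extensions[of UNIV] member_extension by (simp add: members_def)

lemma before_subset: "before \<delta> \<subseteq> members"
  by (auto simp: before_def members_def)

lemma member_inj:
  assumes "member \<gamma> = Some p" "member \<delta> = Some q" "fst p = fst q"
  shows "\<gamma> = \<delta>"
proof (rule ccontr)
  assume "\<gamma> \<noteq> \<delta>"
  then consider "p \<in> before \<delta>" | "q \<in> before \<gamma>"
    using stage_order_total assms by (fastforce simp: before_def)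
  then have "finite (fst p \<inter> fst q)"
    using member_extension[OF assms(1)] member_extension[OF assms(2)]
    by cases (auto simp: extension_def Int_commute)
  then show False
    using member_extension[OF assms(1)] assms(3) by (simp add: extension_def)
qed

text \<open>No finite subfamily of an infinite almost disjoint family almost covers \<omega>. A
  finite nonempty family has a last stage, whose extension was required to keep \<open>UNIV\<close>
  positive.\<close>

lemma UNIV_positive: "UNIV \<in> positive_sets (fst ` members)"
proof (cases "finite (fst ` members)")
  case False
  have A: "almost_disjoint (fst ` members)"
    using coherent_members by (rule coherent_almost_disjoint)
  then have "{a \<in> fst ` members. infinite (UNIV \<inter> a)} = fst ` members"
    by (auto simp: almost_disjoint_def inf_subsets_def)
  then show ?thesis
    using A False by (intro positive_if_meets_infinitely_many) simp_all
next
  case fin: True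
  let ?D = "{\<gamma>. member \<gamma> \<noteq> None}" and ?r = "|UNIV :: (nat \<Rightarrow> nat set) set|"
  have "finite ?D"
  proof (rule inj_on_finite[OF _ _ fin])
    show "inj_on (\<lambda>\<gamma>. fst (the (member \<gamma>))) ?D"
      by (rule inj_onI) (auto intro: member_inj)
    show "(\<lambda>\<gamma>. fst (the (member \<gamma>))) ` ?D \<subseteq> fst ` members"
      by (auto simp: members_def intro!: rev_image_eqI)
  qed
  show ?thesis
  proof (cases "?D = {}")
    case True
    then have "members = {}"
      by (auto simp: members_def)
    then show ?thesis
      by (intro positive_if_orthogonal) simp_all
  next
    case False
    obtain \<gamma> where \<gamma>: "\<gamma> \<in> ?D" "\<forall>\<delta>\<in>?D. (\<delta>, \<gamma>) \<in> ?r"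
      using maximum_exists[of ?r ?D] \<open>finite ?D\<close> False
      by (auto simp: card_of_well_order_on Field_card_of)
    then obtain p where p: "member \<gamma> = Some p"
      by auto
    have "members \<subseteq> insert p (before \<gamma>)"
    proof
      fix q assume "q \<in> members"
      then obtain \<delta> where \<delta>: "member \<delta> = Some q"
        by (auto simp: members_def)
      show "q \<in> insert p (before \<gamma>)"
      proof (cases "\<delta> = \<gamma>")
        case False
        then have "(\<delta>, \<gamma>) \<in> stage_order"
          using \<gamma>(2) \<delta> by (simp add: stage_order_def)
        then show ?thesis
          using \<delta> by (auto simp: before_def)
      qed (use \<delta> p in simp)
    qed
    then have "fst ` members \<subseteq> insert (fst p) (fst ` before \<gamma>)"
      by auto
    moreover have "UNIV \<in> positive_sets (insert (fst p) (fst ` before \<gamma>))"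
      using member_extension[OF p] by (simp add: extension_def)
    ultimately show ?thesis
      using positive_sets_anti by blast
  qed
qed

text \<open>Positivity for the whole family implies positivity for the part before stage
  \<open>b\<close>, so that stage is not skipped.\<close>

lemma member_exists:
  assumes "range b \<subseteq> positive_sets (fst ` members)"
  shows "\<exists>p. member b = Some p"
proof -
  have "range b \<subseteq> positive_sets (fst ` before b)"
    using assms positive_sets_anti[OF image_mono[OF before_subset]] by blast
  then show ?thesis
    by (subst member_unfold) auto
qed

lemma weakly_tight_members: "weakly_tight (fst ` members)"
  unfolding weakly_tight_def
proof (intro conjI allI impI)
  show "almost_disjoint (fst ` members)"
    using coherent_members by (rule coherent_almost_disjoint)
  fix b :: "nat \<Rightarrow> nat set"
  assume "range b \<subseteq> positive_sets (fst ` members)"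
  then obtain p where p: "member b = Some p"
    using member_exists by blast
  then have "\<exists>\<^sub>\<infinity>n. infinite (b n \<inter> fst p)"
    using member_extension[OF p] by (simp add: extension_def)
  moreover have "p \<in> members"
    using p by (auto simp: members_def)
  ultimately show "\<exists>a\<in>fst ` members. \<exists>\<^sub>\<infinity>n. infinite (b n \<inter> a)"
    by blast
qed

lemma card_members: "|fst ` members| =o continuum"
proof -
  let ?A = "fst ` members"
  \<comment> \<open>Deleting one point gives a second positive set, so that subsets of \<omega> can
    be coded.\<close>
  have "{0} \<notin> positive_sets ?A"
    using positive_sets_infinite by blast
  then have minus: "- {0} \<in> positive_sets ?A"
    using positive_sets_Un[of "{0}" "- {0}" ?A] UNIV_positive by (simp add: Compl_partition)
  \<comment> \<open>Continuum many sequences of positive sets, each of which contributes its own member.\<close>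
  define b :: "nat set \<Rightarrow> nat \<Rightarrow> nat set" where "b Z n = (if n \<in> Z then UNIV else - {0})" for Z n
  have "\<exists>p. member (b Z) = Some p" for Z
    using minus UNIV_positive by (intro member_exists) (auto simp: b_def)
  then obtain p where p: "\<And>Z. member (b Z) = Some (p Z)"
    by metis
  have "inj (\<lambda>Z. fst (p Z))"
  proof (rule injI)
    fix Z Z' assume "fst (p Z) = fst (p Z')"
    then have "b Z = b Z'"
      by (rule member_inj[OF p p])
    then have "n \<in> Z \<longleftrightarrow> n \<in> Z'" for n
      by (auto simp: b_def fun_eq_iff split: if_splits dest!: spec[of _ n])
    then show "Z = Z'"
      by blast
  qed
  moreover have "range (\<lambda>Z. fst (p Z)) \<subseteq> ?A"
    using p by (auto simp: members_def)
  ultimately have "|UNIV :: nat set set| \<le>o |?A|"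
    using card_of_ordLeq by blast
  moreover have "|?A| \<le>o |UNIV :: nat set set|"
    by (rule card_of_mono1) simp
  ultimately show ?thesis
    using continuum_eq_card_nat_sets ordIso_iff_ordLeq ordIso_transitive by blast
qed

end

theorem theorem13:
  shows "(\<ss> <o \<bb> \<longrightarrow> \<ss> =o \<ss>\<^sub>\<omega>\<^sub>\<omega>) \<and>
    (\<ss> <o \<bb> \<longrightarrow> (\<exists>A. weakly_tight A \<and> |A| =o continuum))"
proof (intro conjI impI)
  assume less: "\<ss> <o \<bb>"
  then show "\<ss> =o \<ss>\<^sub>\<omega>\<^sub>\<omega>"
    by (rule splitting_number_eq)
  obtain S where "splitting_family S" "\<ss> = |S|"
    using splitting_number_attained by blast
  then interpret small_splitting S
    using less by unfold_locales simp_all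
  show "\<exists>A. weakly_tight A \<and> |A| =o continuum"
    using weakly_tight_members card_members by blast
qed

end
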